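(* Let $\mathbf{G}$ be a GLUE-scheme with spread $n$, let $0<\delta<\gamma$ and $k,\ell\in\mathbb{N}$, and let $$\Gamma_k[\delta,\gamma]:=\max_{\delta\le|\mathbf{d}|_2\le\gamma}\frac{\kappa_k(\mathbf{e}+\mathbf{d})}{|\mathbf{d}|_2},\qquad \Gamma_\ell[\delta]:=\sup_{0<|\mathbf{d}|_2\le\delta}\frac{\kappa_\ell(\mathbf{e}+\mathbf{d})}{|\mathbf{d}|_2},$$ where $\mathbf{d}$ ranges over $\mathbb{L}^n_{\rm c}$. If $\Gamma_k[\delta,\gamma]<1$ and $\Gamma_\ell[\delta]\le\Gamma<1$ with $\Gamma>0$, then all chains $\mathbf{P}\in\mathbb{E}^{\ge n}[\gamma]$ are straightened by $\mathbf{G}$ at rate $\alpha=-\ell^{-1}\log_2\Gamma$.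
   Context: **Chains.** Fix $d\in\mathbb{N}=\{1,2,\dots\}$ and let $\mathbb{E}:=\mathbb{R}^d$ with Euclidean norm $\|\cdot\|$; points are row vectors. $\mathbb{E}^N$ is the set of chains $\mathbf{P}=[p_0;\dots;p_{N-1}]$ of $N$ points $p_i\in\mathbb{E}$; $\#\mathbf{P}:=N$; $\mathbb{E}^{\ge n}:=\bigcup_{N\ge n}\mathbb{E}^N$. Subchains: $T^n_i\mathbf{P}:=[p_i;\dots;p_{i+n-1}]$, $0\le i\le\#\mathbf{P}-n$, and $T^n\mathbf{P}$ is the set of all of these. Let $e:=[1,0,\dots,0]\in\mathbb{E}$, $\mathbf{E}_N:=[e;2e;\dots;Ne]$ and $\mathbf{e}:=\mathbf{E}_n$. Forward differences: $(\Delta\mathbf{P})_i:=p_{i+1}-p_i$, with iterates $\Delta^k$. Set $|\mathbf{P}|_0:=\max_i\|p_i\|$ and $|\mathbf{P}|_j:=|\Delta^j\mathbf{P}|_0$. Let $\mathbb{L}^n:=\{\mathbf{p}\in\mathbb{E}^n:\Delta^2\mathbf{p}=0\}$, let $\mathbb{L}^n_{\rm c}$ be its orthogonal complement and $\Pi:\mathbb{E}^n\to\mathbb{L}^n$ the orthogonal projection, both with respect to $\langle\mathbf{p},\mathbf{q}\rangle_n=\sum_i\langle p_i,q_i\rangle$. The relative distortion of $\mathbf{p}\in\mathbb{E}^n$ is $\kappa(\mathbf{p}):=|\mathbf{p}|_2/|\Pi\mathbf{p}|_1$ if $\Delta\Pi\mathbf{p}\ne0$ and $\kappa(\mathbf{p}):=\infty$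 otherwise; for $\mathbf{P}\in\mathbb{E}^{\ge n}$, $\kappa(\mathbf{P}):=\max\{\kappa(\mathbf{p}):\mathbf{p}\in T^n\mathbf{P}\}$. For $\gamma>0$, $\mathbb{E}^{\ge n}[\gamma]:=\{\mathbf{P}\in\mathbb{E}^{\ge n}:\kappa(\mathbf{P})\le\gamma\}$. A similarity is a map $S(p)=\varrho pQ+s$ with $\varrho>0$, $Q\in\mathbb{R}^{d\times d}$ orthogonal, $s\in\mathbb{E}$; it acts on chains pointwise. **GLUE-schemes.** Let $m\in\mathbb{N}$ and $n=2m+1$. A map $\mathbf{G}:\mathbb{E}^{\ge n}\to\mathbb{E}^{\ge n}$ with $\#\mathbf{G}(\mathbf{P})=2\#\mathbf{P}-n+1$ is a GLUE-scheme with spread $n$ if: (G) $\mathbf{G}\circ S=S\circ\mathbf{G}$ for all similarities $S$; (L),(U) there are functions $g_0,g_1:\mathbb{E}^{m+1}\to\mathbb{E}$ such that $\mathbf{P}'=\mathbf{G}(\mathbf{P})$ has points $p'_{2i+\lambda}=g_\lambda(p_i,\dots,p_{i+m})$ for $\lambda\in\{0,1\}$, $0\le i<\#\mathbf{P}-m$, and $g_0,g_1$ are $C^{1,\nu}$ in a neighborhood of $\mathbf{E}_{m+1}$ for some $\nu>0$ (the regularity parameter); (E) $\mathbf{G}(\mathbf{e})=(\mathbf{E}_{n+1}+(m+\tau)e)/2$ for some $\tau\in[0,1)$ (the shift), where $(m+\tau)e$ is added to every point. Write $\mathbf{P}^\ell:=\mathbf{G}^\ell(\mathbf{P})$. **Straightening.**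 Let $\kappa_\ell(\mathbf{P}):=\kappa(\mathbf{P}^\ell)$, $\ell\in\mathbb{N}$. A sequence in $\mathbb{R}\cup\{\infty\}$ is essentially bounded if it has only finitely many infinite values and is bounded beyond some index. For $\alpha>0$, the chain $\mathbf{P}$ is straightened by $\mathbf{G}$ at rate $\alpha$ if $(2^{j\alpha}\kappa_j(\mathbf{P}))_{j\in\mathbb{N}}$ is essentially bounded. *)

theory Defs
  imports "HOL-Analysis.Analysis"
begin

section \<open>Chains\<close>

text \<open>
  A chain of \<open>N\<close> points in \<open>\<real>\<^sup>d\<close> is a list of length \<open>N\<close> over \<open>real ^ 'd\<close>, so chains of all lengths
  live in one type. The linear order on \<open>'d\<close> only serves to single out the first coordinate.
\<close>

type_synonym 'd chain = "(real ^ 'd) list"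

definition e1 :: "real ^ 'd::{finite,linorder}" where
  "e1 = axis (Min UNIV) 1"

definition std_chain :: "nat \<Rightarrow> ('d::{finite,linorder}) chain" where
  "std_chain N = map (\<lambda>i. real i *\<^sub>R e1) [1..<Suc N]"

definition chain_add :: "('d::finite) chain \<Rightarrow> 'd chain \<Rightarrow> 'd chain" where
  "chain_add P Q = map2 (+) P Q"

definition chain_sub :: "('d::finite) chain \<Rightarrow> 'd chain \<Rightarrow> 'd chain" where
  "chain_sub P Q = map2 (-) P Q"

definition subchains :: "nat \<Rightarrow> ('d::finite) chain \<Rightarrow> 'd chain set" where
  "subchains n P = {take n (drop i P) | i. i + n \<le> length P}"

text \<open>\<open>map2\<close> stops at the end of the shorter list, so \<open>fdiff P\<close> has one point less than \<open>P\<close>.\<close>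

definition fdiff :: "('d::finite) chain \<Rightarrow> 'd chain" where
  "fdiff P = map2 (\<lambda>p q. q - p) P (tl P)"

text \<open>Meaningful only for chains of more than \<open>j\<close> points (\<open>Max {}\<close> is unspecified).\<close>

definition seminorm :: "nat \<Rightarrow> ('d::finite) chain \<Rightarrow> real" where
  "seminorm j P = Max (norm ` set ((fdiff ^^ j) P))"

definition chain_inner :: "('d::finite) chain \<Rightarrow> 'd chain \<Rightarrow> real" where
  "chain_inner P Q = (\<Sum>i<length P. (P ! i) \<bullet> (Q ! i))"

definition chain_norm :: "('d::finite) chain \<Rightarrow> real" where
  "chain_norm P = sqrt (chain_inner P P)"

definition lin_chains :: "nat \<Rightarrow> ('d::finite) chain set" where
  "lin_chains n = {p. length p = n \<and> (\<forall>x \<in> set ((fdiff ^^ 2) p). x = 0)}"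

definition lin_chains_compl :: "nat \<Rightarrow> ('d::finite) chain set" where
  "lin_chains_compl n = {q. length q = n \<and> (\<forall>p \<in> lin_chains n. chain_inner p q = 0)}"

definition lin_proj :: "('d::finite) chain \<Rightarrow> 'd chain" where
  "lin_proj p = (THE q. q \<in> lin_chains (length p) \<and>
                        chain_sub p q \<in> lin_chains_compl (length p))"


section \<open>Relative distortion\<close>

definition distortion :: "('d::finite) chain \<Rightarrow> ereal" where
  "distortion p =
     (if \<exists>x \<in> set (fdiff (lin_proj p)). x \<noteq> 0
      then ereal (seminorm 2 p / seminorm 1 (lin_proj p)) else \<infinity>)"

definition kappa :: "nat \<Rightarrow> ('d::finite) chain \<Rightarrow> ereal" where
  "kappa n P = Max (distortion ` subchains n P)"

definition chains_bounded :: "nat \<Rightarrow> real \<Rightarrow> ('d::finite) chain set" where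
  "chains_bounded n \<gamma> = {P. n \<le> length P \<and> kappa n P \<le> ereal \<gamma>}"


section \<open>GLUE-schemes\<close>

definition similarity :: "(real ^ 'd \<Rightarrow> real ^ 'd::finite) \<Rightarrow> bool" where
  "similarity S \<longleftrightarrow>
     (\<exists>\<rho> Q s. \<rho> > 0 \<and> orthogonal_matrix Q \<and> S = (\<lambda>p. \<rho> *\<^sub>R (p v* Q) + s))"

text \<open>
  \<open>g\<close> is \<open>C\<^sup>1\<close> with \<open>\<nu>\<close>-Hoelder continuous derivative on a neighbourhood of \<open>X\<close> in the Euclidean space
  of chains with \<open>length X\<close> points. Lists form no normed vector space type, hence Frechet
  differentiability is spelled out; the derivative at \<open>P\<close> is the linear map
  \<open>H \<mapsto> (\<Sum>i<length X. D P i (H ! i))\<close>.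
\<close>

definition C1_holder_near :: "real \<Rightarrow> (('d::finite) chain \<Rightarrow> real ^ 'd) \<Rightarrow> 'd chain \<Rightarrow> bool" where
  "C1_holder_near \<nu> g X \<longleftrightarrow>
     (\<exists>r > 0. \<exists>(D :: 'd chain \<Rightarrow> nat \<Rightarrow> ((real ^ 'd) \<Rightarrow>\<^sub>L (real ^ 'd))) C.
        let U = {P. length P = length X \<and> chain_norm (chain_sub P X) < r} in
          (\<forall>P \<in> U. \<forall>\<epsilon> > 0. \<exists>\<eta> > 0. \<forall>H. length H = length X \<and> chain_norm H < \<eta> \<longrightarrow>
             norm (g (chain_add P H) - g P - (\<Sum>i<length X. blinfun_apply (D P i) (H ! i)))
               \<le> \<epsilon> * chain_norm H) \<and>
          (\<forall>P \<in> U. \<forall>Q \<in> U. \<forall>i < length X.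
             norm (D P i - D Q i) \<le> C * chain_norm (chain_sub P Q) powr \<nu>))"

text \<open>
  \<open>G\<close> is a total function on lists; its values on chains with fewer than \<open>n\<close> points are irrelevant,
  as are those of \<open>g0\<close>, \<open>g1\<close> on chains whose length is not \<open>m + 1\<close>. That \<open>G\<close> maps chains with at
  least \<open>n\<close> points to such chains follows from the length formula.
\<close>

definition GLUE_scheme :: "nat \<Rightarrow> (('d::{finite,linorder}) chain \<Rightarrow> 'd chain) \<Rightarrow> bool" where
  "GLUE_scheme n G \<longleftrightarrow>
     (\<exists>m \<ge> 1. n = 2 * m + 1 \<and>
        (\<forall>P. n \<le> length P \<longrightarrow> length (G P) = 2 * length P - n + 1) \<and>
        (\<forall>S P. similarity S \<and> n \<le> length P \<longrightarrow> G (map S P) = map S (G P)) \<and>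
        (\<exists>g0 g1.
           (\<forall>P i. n \<le> length P \<and> i < length P - m \<longrightarrow>
              G P ! (2 * i) = g0 (take (m + 1) (drop i P)) \<and>
              G P ! (2 * i + 1) = g1 (take (m + 1) (drop i P))) \<and>
           (\<exists>\<nu> > 0. C1_holder_near \<nu> g0 (std_chain (m + 1)) \<and>
                    C1_holder_near \<nu> g1 (std_chain (m + 1)))) \<and>
        (\<exists>\<tau>. 0 \<le> \<tau> \<and> \<tau> < 1 \<and>
           G (std_chain n) =
             map (\<lambda>p. (1 / 2) *\<^sub>R (p + (real m + \<tau>) *\<^sub>R e1)) (std_chain (n + 1))))"

definition kappa_iter ::
  "nat \<Rightarrow> (('d::finite) chain \<Rightarrow> 'd chain) \<Rightarrow> nat \<Rightarrow> 'd chain \<Rightarrow> ereal" where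
  "kappa_iter n G l P = kappa n ((G ^^ l) P)"


section \<open>Straightening\<close>

text \<open>Sequences are indexed by the positive integers; \<open>x 0\<close> is ignored.\<close>

definition ess_bounded :: "(nat \<Rightarrow> ereal) \<Rightarrow> bool" where
  "ess_bounded x \<longleftrightarrow>
     finite {j. 1 \<le> j \<and> x j = \<infinity>} \<and> (\<exists>j0 B. \<forall>j \<ge> j0. 1 \<le> j \<longrightarrow> \<bar>x j\<bar> \<le> ereal B)"

definition straightened ::
  "nat \<Rightarrow> (('d::finite) chain \<Rightarrow> 'd chain) \<Rightarrow> real \<Rightarrow> 'd chain \<Rightarrow> bool" where
  "straightened n G \<alpha> P \<longleftrightarrow>
     \<alpha> > 0 \<and> ess_bounded (\<lambda>j. ereal (2 powr (real j * \<alpha>)) * kappa_iter n G j P)"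

text \<open>
  The supremum in \<open>Gamma_range\<close> is the maximum whenever the latter exists; away from the standard
  chain a GLUE-scheme need not be continuous, so that it need not be attained.
\<close>

definition Gamma_range ::
  "nat \<Rightarrow> (('d::{finite,linorder}) chain \<Rightarrow> 'd chain) \<Rightarrow> nat \<Rightarrow> real \<Rightarrow> real \<Rightarrow> ereal" where
  "Gamma_range n G k \<delta> \<gamma> =
     (SUP d \<in> {d \<in> lin_chains_compl n. \<delta> \<le> seminorm 2 d \<and> seminorm 2 d \<le> \<gamma>}.
        kappa_iter n G k (chain_add (std_chain n) d) / ereal (seminorm 2 d))"

definition Gamma_upto ::
  "nat \<Rightarrow> (('d::{finite,linorder}) chain \<Rightarrow> 'd chain) \<Rightarrow> nat \<Rightarrow> real \<Rightarrow> ereal" where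
  "Gamma_upto n G l \<delta> =
     (SUP d \<in> {d \<in> lin_chains_compl n. 0 < seminorm 2 d \<and> seminorm 2 d \<le> \<delta>}.
        kappa_iter n G l (chain_add (std_chain n) d) / ereal (seminorm 2 d))"

end

theory Submission
  imports Defs
begin

text \<open>
  Every subchain of \<open>G(P)\<close> of length \<open>n\<close> is a subchain of \<open>G(p)\<close> for some window \<open>p\<close> of \<open>P\<close> of length
  \<open>n\<close>, and up to a similarity a window of distortion \<open>x\<close> has the form \<open>e + d\<close> with \<open>d\<close> orthogonal to the
  linear chains and \<open>|d|\<^sub>2 = x\<close>. Hence \<open>k\<close> steps multiply a distortion in \<open>[\<delta>, \<gamma>]\<close> by a factor less than
  one, and \<open>l\<close> steps multiply a distortion in \<open>[0, \<delta>]\<close> by at most \<open>\<Gamma>\<close>. Different windows may need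
  different numbers of steps before their distortion is small; as decay is an asymptotic property
  and a chain has only finitely many windows, it may be established for each window separately, by
  induction on the number of contractions. Once the distortion is small, the differentiability of
  the scheme at \<open>e\<close> bounds it at the intermediate steps between multiples of \<open>l\<close>.
\<close>

section \<open>Mean, slope and second differences\<close>

text \<open>Counting indices from the midpoint makes the weights sum to zero, so that the constant
  part and the sloped part of a linear chain are orthogonal and mean and slope decouple.\<close>

definition centre :: "nat \<Rightarrow> nat \<Rightarrow> real" where
  "centre n i = real i - (real n - 1) / 2"

definition chain_mean :: "('d::finite) chain \<Rightarrow> real ^ 'd" where
  "chain_mean p = (\<Sum>i<length p. p ! i) /\<^sub>R real (length p)"

text \<open>The least-squares slope of the points against their index. Together with
  \<open>chain_mean\<close> it gives the coordinates of the orthogonal projection onto the linear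
  chains.\<close>

definition chain_slope :: "('d::finite) chain \<Rightarrow> real ^ 'd" where
  "chain_slope p =
     (\<Sum>i<length p. centre (length p) i *\<^sub>R p ! i) /\<^sub>R (\<Sum>i<length p. (centre (length p) i)\<^sup>2)"

lemma sum_centre: "(\<Sum>i<n. centre n i) = 0"
proof -
  have "(\<Sum>i<n. real i) = real n * (real n - 1) / 2"
    by (induction n) (auto simp: field_simps)
  then show ?thesis
    by (simp add: centre_def sum_subtractf)
qed

lemma sum_centre_sq_pos:
  assumes "2 \<le> n"
  shows "0 < (\<Sum>i<n. (centre n i)\<^sup>2)"
proof (rule sum_pos2)
  show "0 < (centre n 0)\<^sup>2" using assms by (simp add: centre_def)
qed (use assms in auto)

lemma chain_mean_affine:
  assumes "length q = n" "0 < n" "\<And>i. i < n \<Longrightarrow> q ! i = a + centre n i *\<^sub>R b"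
  shows "chain_mean q = a"
proof -
  have "(\<Sum>i<n. q ! i) = real n *\<^sub>R a + (\<Sum>i<n. centre n i) *\<^sub>R b"
    using assms by (simp add: sum.distrib scaleR_left.sum sum_constant_scaleR del: sum_constant)
  then show ?thesis
    using assms by (simp add: chain_mean_def sum_centre)
qed

lemma chain_slope_affine:
  assumes "length q = n" "2 \<le> n" "\<And>i. i < n \<Longrightarrow> q ! i = a + centre n i *\<^sub>R b"
  shows "chain_slope q = b"
proof -
  have "(\<Sum>i<n. centre n i *\<^sub>R q ! i) = (\<Sum>i<n. centre n i) *\<^sub>R a + (\<Sum>i<n. (centre n i)\<^sup>2) *\<^sub>R b"
    using assms
    by (simp add: sum.distrib scaleR_left.sum scaleR_right_distrib power2_eq_square)
  then show ?thesis
    using assms sum_centre_sq_pos[of n] by (simp add: chain_slope_def sum_centre)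
qed

lemma nth_chain_add [simp]:
  "i < length p \<Longrightarrow> i < length q \<Longrightarrow> chain_add p q ! i = p ! i + q ! i"
  and length_chain_add [simp]: "length (chain_add p q) = min (length p) (length q)"
  and nth_chain_sub [simp]:
  "i < length p \<Longrightarrow> i < length q \<Longrightarrow> chain_sub p q ! i = p ! i - q ! i"
  and length_chain_sub [simp]: "length (chain_sub p q) = min (length p) (length q)"
  by (simp_all add: chain_add_def chain_sub_def)

lemma chain_mean_sub:
  "length p = length q \<Longrightarrow> chain_mean (chain_sub p q) = chain_mean p - chain_mean q"
  by (simp add: chain_mean_def sum_subtractf scaleR_right_diff_distrib)

lemma chain_slope_sub:
  "length p = length q \<Longrightarrow> chain_slope (chain_sub p q) = chain_slope p - chain_slope q"
  by (simp add: chain_slope_def sum_subtractf scaleR_right_diff_distrib)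

section \<open>Forward differences and the second-difference seminorm\<close>

lemma length_fdiff [simp]: "length (fdiff P) = length P - 1"
  by (simp add: fdiff_def)

lemma nth_fdiff [simp]: "Suc i < length P \<Longrightarrow> fdiff P ! i = P ! Suc i - P ! i"
  by (simp add: fdiff_def nth_tl)

lemma length_fdiff2: "length ((fdiff ^^ 2) P) = length P - 2"
  by (simp add: numeral_2_eq_2)

lemma nth_fdiff2:
  "i + 2 < length P \<Longrightarrow> (fdiff ^^ 2) P ! i = P ! (i + 2) - 2 *\<^sub>R P ! (i + 1) + P ! i"
  by (simp add: numeral_2_eq_2 scaleR_2)

text \<open>Three points make the list of second differences nonempty, so the maximum is genuine and
  can be tested entry by entry.\<close>

lemma seminorm2_le_iff:
  assumes "3 \<le> length p"
  shows "seminorm 2 p \<le> c \<longleftrightarrow> (\<forall>i. i + 2 < length p \<longrightarrow> norm (p ! (i + 2) - 2 *\<^sub>R p ! (i + 1) + p ! i) \<le> c)"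
proof -
  have "(fdiff ^^ 2) p \<noteq> []"
    using assms length_fdiff2[of p] by force
  then have "seminorm 2 p \<le> c \<longleftrightarrow> (\<forall>x\<in>set ((fdiff ^^ 2) p). norm x \<le> c)"
    by (simp add: seminorm_def)
  also have "\<dots> \<longleftrightarrow> (\<forall>i<length p - 2. norm ((fdiff ^^ 2) p ! i) \<le> c)"
    by (auto simp: all_set_conv_all_nth length_fdiff2)
  finally show ?thesis by (simp add: nth_fdiff2 less_diff_conv)
qed

lemma second_diff_le_seminorm2:
  "i + 2 < length p \<Longrightarrow> norm (p ! (i + 2) - 2 *\<^sub>R p ! (i + 1) + p ! i) \<le> seminorm 2 p"
  using seminorm2_le_iff[of p "seminorm 2 p"] by simp

lemma seminorm2_nonneg: "3 \<le> length p \<Longrightarrow> 0 \<le> seminorm 2 p"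
  by (rule order_trans[OF norm_ge_zero second_diff_le_seminorm2[of 0]]) simp

text \<open>Comparing second differences entry by entry serves two purposes: similarities, with
  \<open>c\<close> the scaling factor, and subtraction of a linear chain, with
  \<open>c = 1\<close>.\<close>

lemma seminorm2_cong_scale:
  assumes "3 \<le> length p" "length q = length p" "0 < c"
    and "\<And>i. i + 2 < length p \<Longrightarrow> norm (q ! (i + 2) - 2 *\<^sub>R q ! (i + 1) + q ! i)
           = c * norm (p ! (i + 2) - 2 *\<^sub>R p ! (i + 1) + p ! i)"
  shows "seminorm 2 q = c * seminorm 2 p"
proof (rule antisym)
  have "3 \<le> length q" using assms(1,2) by simp
  then show "seminorm 2 q \<le> c * seminorm 2 p"
    using assms(2-4) second_diff_le_seminorm2[of _ p] mult_left_mono[of _ _ c]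
    by (simp add: seminorm2_le_iff)
  have "seminorm 2 p \<le> seminorm 2 q / c"
  proof (subst seminorm2_le_iff[OF assms(1)], intro allI impI)
    fix i assume i: "i + 2 < length p"
    then have "c * norm (p ! (i + 2) - 2 *\<^sub>R p ! (i + 1) + p ! i) \<le> seminorm 2 q"
      using assms(2) assms(4)[OF i] second_diff_le_seminorm2[of i q] by simp
    then show "norm (p ! (i + 2) - 2 *\<^sub>R p ! (i + 1) + p ! i) \<le> seminorm 2 q / c"
      using \<open>0 < c\<close> by (simp add: field_simps)
  qed
  then show "c * seminorm 2 p \<le> seminorm 2 q"
    using \<open>0 < c\<close> by (simp add: field_simps)
qed

section \<open>The projection onto linear chains\<close>

text \<open>The recurrence \<open>f (i + 2) = 2 *\<^sub>R f (i + 1) - f i\<close> fixes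
  \<open>f\<close> by its first two values; the induction looks back two places.\<close>

lemma second_diff_zero_affine:
  fixes f :: "nat \<Rightarrow> 'a::real_vector"
  assumes "\<And>i. i + 2 < n \<Longrightarrow> f (i + 2) - 2 *\<^sub>R f (i + 1) + f i = 0"
  shows "i < n \<Longrightarrow> f i = f 0 + real i *\<^sub>R (f 1 - f 0)"
proof (induction i rule: less_induct)
  case (less i)
  have "i = 0 \<or> i = 1 \<or> i = (i - 2) + 2" by linarith
  then consider "i = 0" | "i = 1" | j where "i = j + 2" by blast
  then show ?case
  proof cases
    case 3
    define v where "v = f 1 - f 0"
    have "f j = f 0 + real j *\<^sub>R v" "f (j + 1) = f 0 + real (j + 1) *\<^sub>R v"
      using less.IH[of j] less.IH[of "j + 1"] less.prems 3 by (simp_all add: v_def)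
    moreover have "f i = 2 *\<^sub>R f (j + 1) - f j"
      using assms[of j] less.prems 3 by (simp add: algebra_simps eq_diff_eq)
    ultimately have "f i = 2 *\<^sub>R (f 0 + real (j + 1) *\<^sub>R v) - (f 0 + real j *\<^sub>R v)"
      by simp
    then show ?thesis
      unfolding v_def[symmetric] using 3 by (simp add: algebra_simps scaleR_2 del: scaleR_scaleR)
  qed auto
qed

lemma lin_chains_iff:
  assumes "3 \<le> n"
  shows "p \<in> lin_chains n \<longleftrightarrow> length p = n \<and> (\<exists>a b. \<forall>i<n. p ! i = a + centre n i *\<^sub>R b)"
    (is "?L \<longleftrightarrow> ?R")
proof
  assume L: ?L
  then have len: "length p = n" by (simp add: lin_chains_def)
  have "p ! (i + 2) - 2 *\<^sub>R p ! (i + 1) + p ! i = 0" if "i + 2 < n" for i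
  proof -
    have "(fdiff ^^ 2) p ! i \<in> set ((fdiff ^^ 2) p)"
      using that len by (intro nth_mem) (simp add: length_fdiff2)
    then show ?thesis using L that len by (simp add: lin_chains_def nth_fdiff2)
  qed
  note * = second_diff_zero_affine[of n "(!) p", OF this]
  \<comment> \<open>The base point moves from index 0 to the midpoint, which adds
    \<open>(real n - 1) / 2\<close> increments.\<close>
  have "p ! i = (p ! 0 + ((real n - 1) / 2) *\<^sub>R (p ! 1 - p ! 0)) + centre n i *\<^sub>R (p ! 1 - p ! 0)"
    if "i < n" for i
    by (subst *[OF _ that]) (auto simp: centre_def algebra_simps)
  then show ?R using len by blast
next
  assume ?R
  then obtain a b where len: "length p = n" and p: "\<And>i. i < n \<Longrightarrow> p ! i = a + centre n i *\<^sub>R b"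
    by blast
  have "(fdiff ^^ 2) p ! i = 0" if "i < n - 2" for i
    using that len by (simp add: nth_fdiff2 p centre_def vec_eq_iff field_simps)
  then show ?L
    using len by (auto simp: lin_chains_def in_set_conv_nth length_fdiff2)
qed

text \<open>The inner product of \<open>q\<close> with the linear chain of mean \<open>a\<close> and
  slope \<open>b\<close> is a linear form in \<open>a\<close> and \<open>b\<close>; its coefficients
  are positive multiples of the mean and the slope of \<open>q\<close>.\<close>

lemma lin_chains_compl_iff:
  assumes "3 \<le> n"
  shows "q \<in> lin_chains_compl n \<longleftrightarrow> length q = n \<and> chain_mean q = 0 \<and> chain_slope q = 0"
    (is "?L \<longleftrightarrow> ?R")
proof -
  have inner: "chain_inner p q = a \<bullet> (\<Sum>i<n. q ! i) + b \<bullet> (\<Sum>i<n. centre n i *\<^sub>R q ! i)"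
    if "length p = n" "\<And>i. i < n \<Longrightarrow> p ! i = a + centre n i *\<^sub>R b" for p a b
    using that by (simp add: chain_inner_def inner_add_left sum.distrib inner_sum_right)
  have mean0: "chain_mean q = 0 \<longleftrightarrow> (\<Sum>i<n. q ! i) = 0" if "length q = n"
    using that assms by (simp add: chain_mean_def)
  have slope0: "chain_slope q = 0 \<longleftrightarrow> (\<Sum>i<n. centre n i *\<^sub>R q ! i) = 0" if "length q = n"
    using that assms sum_centre_sq_pos[of n] by (simp add: chain_slope_def)
  show ?thesis
  proof
    assume L: ?L
    then have len: "length q = n" by (simp add: lin_chains_compl_def)
    have *: "a \<bullet> (\<Sum>i<n. q ! i) + b \<bullet> (\<Sum>i<n. centre n i *\<^sub>R q ! i) = 0" for a b
    proof -
      let ?p = "map (\<lambda>i. a + centre n i *\<^sub>R b) [0..<n]"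
      have "?p \<in> lin_chains n" using assms by (auto simp: lin_chains_iff)
      then have "chain_inner ?p q = 0" using L by (simp add: lin_chains_compl_def)
      then show ?thesis using inner[of ?p a b] by simp
    qed
    \<comment> \<open>Each sum is tested against itself, with the other parameter zero, so its
      squared norm vanishes.\<close>
    show ?R
      using len mean0 slope0 *[of "\<Sum>i<n. q ! i" 0] *[of 0 "\<Sum>i<n. centre n i *\<^sub>R q ! i"] by simp
  next
    assume R: ?R
    then have "chain_inner p q = 0" if "p \<in> lin_chains n" for p
      using that assms inner[of p] mean0 slope0 by (auto simp: lin_chains_iff)
    then show ?L using R by (simp add: lin_chains_compl_def)
  qed
qed

text \<open>The affine chain with the mean and slope of \<open>p\<close> leaves a residual with mean
  and slope zero, which is orthogonal to the linear chains. Conversely, an orthogonal residual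
  forces the mean and slope of the linear part, so the \<open>THE\<close> has a unique
  witness.\<close>

lemma lin_proj_eq:
  assumes "3 \<le> length p"
  shows "lin_proj p = map (\<lambda>i. chain_mean p + centre (length p) i *\<^sub>R chain_slope p) [0..<length p]"
    (is "_ = ?q")
proof -
  let ?n = "length p"
  have "?q \<in> lin_chains ?n" using assms by (auto simp: lin_chains_iff)
  moreover have "chain_sub p ?q \<in> lin_chains_compl ?n"
  proof -
    have "chain_mean ?q = chain_mean p"
      using assms by (intro chain_mean_affine) auto
    moreover have "chain_slope ?q = chain_slope p"
      using assms by (intro chain_slope_affine) auto
    ultimately show ?thesis
      using assms by (simp add: lin_chains_compl_iff chain_mean_sub chain_slope_sub)
  qed
  moreover have "q = ?q" if "q \<in> lin_chains ?n" "chain_sub p q \<in> lin_chains_compl ?n" for q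
  proof -
    obtain a b where len: "length q = ?n" and q: "\<And>i. i < ?n \<Longrightarrow> q ! i = a + centre ?n i *\<^sub>R b"
      using \<open>q \<in> lin_chains ?n\<close> assms by (auto simp: lin_chains_iff)
    have "chain_mean q = a" using len q assms by (intro chain_mean_affine[of _ ?n]) auto
    moreover have "chain_slope q = b" using len q assms by (intro chain_slope_affine[of _ ?n]) auto
    ultimately have "chain_mean p = a" "chain_slope p = b"
      using that(2) assms len by (auto simp: lin_chains_compl_iff chain_mean_sub chain_slope_sub)
    then show ?thesis using len q by (intro nth_equalityI) auto
  qed
  ultimately show ?thesis
    unfolding lin_proj_def by (intro the_equality) blast+
qed

text \<open>All first differences of the projection equal \<open>chain_slope p\<close>, so its norm
  is the denominator and the infinite case is that of slope zero.\<close>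

lemma distortion_eq:
  assumes "3 \<le> length p"
  shows "distortion p =
    (if chain_slope p = 0 then \<infinity> else ereal (seminorm 2 p / norm (chain_slope p)))"
proof -
  let ?n = "length p"
  have "fdiff (lin_proj p) = replicate (?n - 1) (chain_slope p)"
    using assms by (intro nth_equalityI) (auto simp: lin_proj_eq centre_def algebra_simps)
  then have "set (fdiff (lin_proj p)) = {chain_slope p}"
    using assms by simp
  then show ?thesis
    by (simp add: distortion_def seminorm_def)
qed

lemma distortion_nonneg: "3 \<le> length p \<Longrightarrow> 0 \<le> distortion p"
  by (simp add: distortion_eq seminorm2_nonneg)

section \<open>Similarities\<close>

text \<open>Points are row vectors in \<open>similarity\<close>, while \<open>matrix f\<close> acts
  on columns; hence the transpose.\<close>

lemma similarity_orthogonal_transformation: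
  assumes "0 < \<rho>" "orthogonal_transformation f"
  shows "similarity (\<lambda>p. \<rho> *\<^sub>R f p + s)"
proof -
  have "linear f" "orthogonal_matrix (matrix f)"
    using assms(2) orthogonal_transformation_matrix by blast+
  moreover have "f p = p v* transpose (matrix f)" for p
    using \<open>linear f\<close> by (simp add: matrix_works flip: linear_matrix_vector_mul_eq)
  ultimately show ?thesis
    using assms(1) unfolding similarity_def
    by (intro exI[of _ \<rho>] exI[of _ "transpose (matrix f)"] exI[of _ s]) auto
qed

text \<open>The translation \<open>s\<close> enters the mean with total weight one and drops out of
  the slope, because the centred indices sum to zero.\<close>

lemma
  assumes "linear f" "3 \<le> length p"
  shows chain_mean_map_similarity:
      "chain_mean (map (\<lambda>x. \<rho> *\<^sub>R f x + s) p) = \<rho> *\<^sub>R f (chain_mean p) + s"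
    and chain_slope_map_similarity:
      "chain_slope (map (\<lambda>x. \<rho> *\<^sub>R f x + s) p) = \<rho> *\<^sub>R f (chain_slope p)"
proof -
  have one: "inverse (real (length p)) * real (length p) = 1"
    using assms(2) by (intro left_inverse) (auto simp only: of_nat_eq_0_iff)
  have "(\<Sum>i<length p. \<rho> *\<^sub>R f (p ! i) + s)
      = \<rho> *\<^sub>R f (\<Sum>i<length p. p ! i) + real (length p) *\<^sub>R s"
    by (simp only: sum.distrib linear_sum[OF assms(1)] scaleR_right.sum sum_constant_scaleR)
      simp
  then show "chain_mean (map (\<lambda>x. \<rho> *\<^sub>R f x + s) p) = \<rho> *\<^sub>R f (chain_mean p) + s"
    using one by (simp add: chain_mean_def linear_scale[OF assms(1)] scaleR_right_distrib mult.commute)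
  have "(\<Sum>i<length p. centre (length p) i *\<^sub>R (\<rho> *\<^sub>R f (p ! i) + s))
      = \<rho> *\<^sub>R f (\<Sum>i<length p. centre (length p) i *\<^sub>R p ! i)
        + (\<Sum>i<length p. centre (length p) i) *\<^sub>R s"
    by (simp only: scaleR_right_distrib sum.distrib scaleR_left.sum scaleR_right.sum
        scaleR_left_commute linear_sum[OF assms(1)] linear_scale[OF assms(1)])
  then show "chain_slope (map (\<lambda>x. \<rho> *\<^sub>R f x + s) p) = \<rho> *\<^sub>R f (chain_slope p)"
    by (simp add: chain_slope_def sum_centre linear_scale[OF assms(1)] mult.commute)
qed

lemma seminorm2_map_similarity:
  assumes "orthogonal_transformation f" "0 < \<rho>" "3 \<le> length p"
  shows "seminorm 2 (map (\<lambda>x. \<rho> *\<^sub>R f x + s) p) = \<rho> * seminorm 2 p"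
proof (rule seminorm2_cong_scale)
  have f: "linear f" using assms(1) by (rule orthogonal_transformation_linear)
  fix i assume "i + 2 < length p"
  then have "map (\<lambda>x. \<rho> *\<^sub>R f x + s) p ! (i + 2) - 2 *\<^sub>R map (\<lambda>x. \<rho> *\<^sub>R f x + s) p ! (i + 1)
      + map (\<lambda>x. \<rho> *\<^sub>R f x + s) p ! i
    = \<rho> *\<^sub>R (f (p ! (i + 2)) - 2 *\<^sub>R f (p ! (i + 1)) + f (p ! i))"
    by (simp add: vec_eq_iff field_simps)
  also have "\<dots> = \<rho> *\<^sub>R f (p ! (i + 2) - 2 *\<^sub>R p ! (i + 1) + p ! i)"
    using f by (simp add: linear_add linear_diff linear_scale)
  finally show "norm (map (\<lambda>x. \<rho> *\<^sub>R f x + s) p ! (i + 2) - 2 *\<^sub>R map (\<lambda>x. \<rho> *\<^sub>R f x + s) p ! (i + 1)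
      + map (\<lambda>x. \<rho> *\<^sub>R f x + s) p ! i)
    = \<rho> * norm (p ! (i + 2) - 2 *\<^sub>R p ! (i + 1) + p ! i)"
    using assms by (simp add: orthogonal_transformation_norm)
qed (use assms in auto)

text \<open>Numerator and denominator both scale by \<open>\<rho>\<close>, and norm preservation
  keeps zero and nonzero slopes apart.\<close>

lemma distortion_map_similarity:
  assumes "orthogonal_transformation f" "0 < \<rho>" "3 \<le> length p"
  shows "distortion (map (\<lambda>x. \<rho> *\<^sub>R f x + s) p) = distortion p"
  using assms orthogonal_transformation_linear[OF assms(1)] orthogonal_transformation_norm[OF assms(1)]
  by (simp add: distortion_eq seminorm2_map_similarity chain_slope_map_similarity)
    (metis norm_eq_zero)

section \<open>Subchains\<close>

lemma subchains_eq_image: "n \<le> length P \<Longrightarrow> subchains n P = (\<lambda>i. take n (drop i P)) ` {..length P - n}"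
  by (auto simp: subchains_def)

lemma finite_subchains [simp]: "finite (subchains n P)"
proof (cases "n \<le> length P")
  case False
  then have "subchains n P = {}" by (auto simp: subchains_def)
  then show ?thesis by simp
qed (simp add: subchains_eq_image)

lemma subchains_nonempty: "n \<le> length P \<Longrightarrow> subchains n P \<noteq> {}"
  by (simp add: subchains_eq_image)

lemma length_subchain: "p \<in> subchains n P \<Longrightarrow> length p = n"
  by (auto simp: subchains_def)

lemma subchains_self: "length p = n \<Longrightarrow> subchains n p = {p}"
  by (auto simp: subchains_def)

lemma subchains_map: "subchains n (map f P) = map f ` subchains n P"
  by (auto simp: subchains_def take_map drop_map)

lemma kappa_le_iff: "n \<le> length P \<Longrightarrow> kappa n P \<le> c \<longleftrightarrow> (\<forall>p\<in>subchains n P. distortion p \<le> c)"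
  by (simp add: kappa_def subchains_nonempty)

lemma distortion_le_kappa: "p \<in> subchains n P \<Longrightarrow> distortion p \<le> kappa n P"
  by (simp add: kappa_def)

lemma kappa_self: "length p = n \<Longrightarrow> kappa n p = distortion p"
  by (simp add: kappa_def subchains_self)

lemma kappa_nonneg:
  assumes "3 \<le> n" "n \<le> length P"
  shows "0 \<le> kappa n P"
proof -
  obtain p where p: "p \<in> subchains n P" using subchains_nonempty[OF assms(2)] by blast
  then have "0 \<le> distortion p" using assms(1) by (simp add: distortion_nonneg length_subchain)
  also have "\<dots> \<le> kappa n P" using p by (rule distortion_le_kappa)
  finally show ?thesis .
qed

lemma kappa_map_similarity:
  assumes "orthogonal_transformation f" "0 < \<rho>" "3 \<le> n"
  shows "kappa n (map (\<lambda>x. \<rho> *\<^sub>R f x + s) P) = kappa n P"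
proof -
  have "distortion ` subchains n (map (\<lambda>x. \<rho> *\<^sub>R f x + s) P) = distortion ` subchains n P"
    using assms by (simp add: subchains_map image_image distortion_map_similarity length_subchain)
  then show ?thesis by (simp add: kappa_def)
qed

section \<open>Locality of GLUE-schemes\<close>

lemma
  assumes "GLUE_scheme n G"
  shows GLUE_ge_3: "3 \<le> n"
    and GLUE_length: "n \<le> length P \<Longrightarrow> length (G P) = 2 * length P - n + 1"
    and GLUE_similarity: "similarity S \<Longrightarrow> n \<le> length P \<Longrightarrow> G (map S P) = map S (G P)"
  using assms unfolding GLUE_scheme_def by auto

lemma GLUE_iter_length:
  assumes "GLUE_scheme n G" "n \<le> length P"
  shows "n \<le> length ((G ^^ j) P)"
  by (induction j) (use assms in \<open>auto simp: GLUE_length\<close>)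

lemma GLUE_iter_similarity:
  assumes "GLUE_scheme n G" "similarity S" "n \<le> length P"
  shows "(G ^^ j) (map S P) = map S ((G ^^ j) P)"
  by (induction j) (use assms in \<open>auto simp: GLUE_similarity GLUE_iter_length\<close>)

text \<open>A window of \<open>n = 2 * m + 1\<close> points contains \<open>m + 1\<close> stretches
  of \<open>m + 1\<close> points, each of which determines two points of the image. This yields the
  \<open>n + 1\<close> consecutive points of \<open>G P\<close> that start at
  \<open>2 * i\<close>.\<close>

lemma GLUE_window:
  assumes "GLUE_scheme n G" "i + n \<le> length P"
  shows "G (take n (drop i P)) = take (n + 1) (drop (2 * i) (G P))"
proof -
  obtain m g0 g1 where n: "n = 2 * m + 1"
    and g: "\<And>P i. n \<le> length P \<Longrightarrow> i < length P - m \<Longrightarrow>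
              G P ! (2 * i) = g0 (take (m + 1) (drop i P)) \<and>
              G P ! (2 * i + 1) = g1 (take (m + 1) (drop i P))"
    using assms(1) unfolding GLUE_scheme_def by metis
  let ?p = "take n (drop i P)"
  have len: "length ?p = n" "length (G ?p) = n + 1" "length (G P) = 2 * length P - n + 1"
    using assms by (simp_all add: GLUE_length[OF assms(1)])
  show ?thesis
  proof (rule nth_equalityI)
    show "length (G ?p) = length (take (n + 1) (drop (2 * i) (G P)))"
      using len assms(2) by auto
    fix t assume "t < length (G ?p)"
    then have t: "t < n + 1" using len by simp
    \<comment> \<open>Point \<open>t\<close> comes from the \<open>j\<close>-th stretch, by
      \<open>g0\<close> or \<open>g1\<close> according to the parity of \<open>t\<close>.\<close>
    define j where "j = t div 2"
    have tj: "t = 2 * j \<or> t = 2 * j + 1" unfolding j_def by linarith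
    have j: "j \<le> m" using t n tj by linarith
    have window: "take (m + 1) (drop j ?p) = take (m + 1) (drop (i + j) P)"
      using j n by (simp add: drop_take add.commute)
    have "G ?p ! t = G P ! (2 * i + t)"
      using tj g[of ?p j] g[of P "i + j"] len j n assms(2) window
      by (auto simp: distrib_left simp flip: add.assoc)
    then show "G ?p ! t = take (n + 1) (drop (2 * i) (G P)) ! t"
      using t len assms(2) by simp
  qed
qed

lemma subchains_take_drop_subset:
  "subchains n (take l (drop i P)) \<subseteq> subchains n P"
proof
  fix Q assume "Q \<in> subchains n (take l (drop i P))"
  then obtain j where j: "Q = take n (drop j (take l (drop i P)))"
    "j + n \<le> min l (length P - i)"
    by (auto simp: subchains_def)
  show "Q \<in> subchains n P"
  \<comment> \<open>The empty subchain is found at offset 0, since \<open>i\<close> may lie beyond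
    the end of \<open>P\<close>.\<close>
  proof (cases "n = 0")
    case True
    then show ?thesis using j by (auto simp: subchains_def intro: exI[of _ 0])
  next
    case False
    then have "Q = take n (drop (i + j) P)" "i + j + n \<le> length P"
      using j by (auto simp: drop_take add.commute)
    then show ?thesis by (auto simp: subchains_def)
  qed
qed

lemma GLUE_subchains_mono:
  assumes "GLUE_scheme n G" "R \<in> subchains n P"
  shows "subchains n (G R) \<subseteq> subchains n (G P)"
proof -
  obtain i where "R = take n (drop i P)" "i + n \<le> length P"
    using assms(2) by (auto simp: subchains_def)
  then show ?thesis
    using GLUE_window[OF assms(1)] subchains_take_drop_subset by metis
qed

text \<open>The image of a window has one point more than \<open>n\<close>, so the window at
  \<open>t div 2\<close> accommodates a subchain starting at \<open>t\<close> for either parity of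
  \<open>t\<close>.\<close>

lemma GLUE_subchains_cover:
  assumes G: "GLUE_scheme n G" and P: "n \<le> length P" and Q: "Q \<in> subchains n (G P)"
  shows "\<exists>p\<in>subchains n P. Q \<in> subchains n (G p)"
proof -
  obtain t where t: "Q = take n (drop t (G P))" "t + n \<le> 2 * length P - n + 1"
    using Q P by (auto simp: subchains_def GLUE_length[OF G])
  define i where "i = t div 2"
  have i: "t = 2 * i \<or> t = 2 * i + 1" unfolding i_def by linarith
  \<comment> \<open>The bound on \<open>t\<close> gives
    \<open>2 * (i + n) \<le> 2 * length P + 1\<close>, and integrality removes the extra
    one.\<close>
  have i': "i + n \<le> length P" using i t(2) P by linarith
  let ?p = "take n (drop i P)"
  have "?p \<in> subchains n P" using i' by (auto simp: subchains_def)
  moreover have "Q = take n (drop (t - 2 * i) (G ?p))"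
    using i t(1) by (auto simp: GLUE_window[OF G i'] drop_take)
  moreover have "t - 2 * i + n \<le> length (G ?p)"
    using i i' by (simp add: GLUE_length[OF G]) linarith
  ultimately show ?thesis by (auto simp: subchains_def)
qed

text \<open>The subchain is traced back one step at a time: \<open>Q\<close> lies in
  \<open>G R\<close>, the induction hypothesis places \<open>R\<close> in \<open>(G ^^ j) p\<close>,
  and monotonicity carries \<open>Q\<close> into the next iterate.\<close>

lemma GLUE_iter_subchains_cover:
  assumes G: "GLUE_scheme n G" and "n \<le> length P" "Q \<in> subchains n ((G ^^ j) P)"
  shows "\<exists>p\<in>subchains n P. Q \<in> subchains n ((G ^^ j) p)"
  using assms(2,3)
proof (induction j arbitrary: Q)
  case 0
  have "Q \<in> subchains n P" using 0(2) by simp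
  moreover have "Q \<in> subchains n Q"
    using length_subchain[OF \<open>Q \<in> subchains n P\<close>] by (simp add: subchains_self)
  ultimately show ?case by auto
next
  case (Suc j)
  then obtain R where "R \<in> subchains n ((G ^^ j) P)" and QR: "Q \<in> subchains n (G R)"
    using GLUE_subchains_cover[OF G GLUE_iter_length[OF G Suc.prems(1)], of Q j] by auto
  then obtain p where "p \<in> subchains n P" "R \<in> subchains n ((G ^^ j) p)"
    using Suc by blast
  then show ?case using QR GLUE_subchains_mono[OF G] by auto
qed

lemma GLUE_kappa_iter_le:
  assumes "GLUE_scheme n G" "n \<le> length P"
    and "\<And>p. p \<in> subchains n P \<Longrightarrow> kappa n ((G ^^ j) p) \<le> c"
  shows "kappa n ((G ^^ j) P) \<le> c"
proof -
  have "distortion Q \<le> c" if "Q \<in> subchains n ((G ^^ j) P)" for Q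
    using GLUE_iter_subchains_cover[OF assms(1,2) that] assms(3) distortion_le_kappa order_trans
    by metis
  then show ?thesis
    using GLUE_iter_length[OF assms(1,2)] by (simp add: kappa_le_iff)
qed

section \<open>Normal form under similarities\<close>

lemma norm_e1 [simp]: "norm (e1 :: real ^ 'd::{finite,linorder}) = 1"
  by (simp add: e1_def)

lemma length_std_chain [simp]: "length (std_chain n) = n"
  by (simp add: std_chain_def)

lemma nth_std_chain [simp]: "i < n \<Longrightarrow> std_chain n ! i = real (i + 1) *\<^sub>R e1"
  by (simp add: std_chain_def del: upt_Suc)

text \<open>A similarity turns the slope of \<open>p\<close> into \<open>e1\<close> and its mean
  into that of the standard chain, so the difference \<open>d\<close> has mean and slope zero.
  Subtracting a linear chain leaves second differences unchanged, and the scaling by the inverse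
  slope turns \<open>seminorm 2 p\<close> into the distortion. The chain \<open>d\<close> is chosen
  before \<open>G\<close> and \<open>j\<close>, so it serves all iterates at once.\<close>

lemma distortion_normal_form:
  fixes p :: "('d::{finite,linorder}) chain"
  assumes p: "length p = n" "3 \<le> n" and slope: "chain_slope p \<noteq> 0"
  obtains d :: "'d chain" where "d \<in> lin_chains_compl n" "distortion p = ereal (seminorm 2 d)"
    "\<And>G j. GLUE_scheme n G \<Longrightarrow> kappa_iter n G j (chain_add (std_chain n) d) = kappa n ((G ^^ j) p)"
proof -
  let ?e = "std_chain n :: 'd chain"
  let ?v = "chain_slope p"
  define \<rho> where "\<rho> = 1 / norm ?v"
  have \<rho>: "0 < \<rho>" using slope by (simp add: \<rho>_def)
  \<comment> \<open>Two vectors of equal norm are related by an orthogonal map.\<close>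
  obtain f where f: "orthogonal_transformation f" and "f ?v = norm ?v *\<^sub>R (e1 :: (real, 'd) vec)"
    using orthogonal_transformation_exists[of ?v "norm ?v *\<^sub>R (e1 :: (real, 'd) vec)"] by auto
  then have fv: "\<rho> *\<^sub>R f ?v = e1" using slope by (simp add: \<rho>_def)
  have lin: "linear f" using f by (rule orthogonal_transformation_linear)
  define s where "s = chain_mean ?e - \<rho> *\<^sub>R f (chain_mean p)"
  define S where "S = (\<lambda>x. \<rho> *\<^sub>R f x + s)"
  define d where "d = chain_sub (map S p) ?e"
  have e: "?e ! i = ((real n + 1) / 2) *\<^sub>R e1 + centre n i *\<^sub>R e1" if "i < n" for i
  proof -
    have "real (i + 1) = (real n + 1) / 2 + centre n i" by (simp add: centre_def field_simps)
    then show ?thesis using that by (simp only: nth_std_chain scaleR_left_distrib)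
  qed
  have slope_e: "chain_slope ?e = e1" by (rule chain_slope_affine[OF _ _ e]) (use p in auto)
  have len: "length d = n" using p by (simp add: d_def)
  have "chain_mean d = 0"
    using p lin by (simp add: d_def chain_mean_sub S_def chain_mean_map_similarity s_def)
  moreover have "chain_slope d = 0"
    using p lin by (simp add: d_def chain_slope_sub S_def chain_slope_map_similarity slope_e fv)
  ultimately have "d \<in> lin_chains_compl n" using p len by (simp add: lin_chains_compl_iff)
  moreover have "distortion p = ereal (seminorm 2 d)"
  proof -
    have "seminorm 2 d = 1 * seminorm 2 (map S p)"
    proof (rule seminorm2_cong_scale)
      fix i assume i: "i + 2 < length (map S p)"
      then have "d ! (i + 2) - 2 *\<^sub>R d ! (i + 1) + d ! i
        = map S p ! (i + 2) - 2 *\<^sub>R map S p ! (i + 1) + map S p ! i"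
        using p by (simp add: d_def vec_eq_iff field_simps)
      then show "norm (d ! (i + 2) - 2 *\<^sub>R d ! (i + 1) + d ! i)
        = 1 * norm (map S p ! (i + 2) - 2 *\<^sub>R map S p ! (i + 1) + map S p ! i)"
        by (simp only: mult_1)
    qed (use p len in auto)
    also have "\<dots> = \<rho> * seminorm 2 p"
      using p seminorm2_map_similarity[OF f \<rho>, of p s] by (simp add: S_def)
    finally show ?thesis using p slope by (simp add: distortion_eq \<rho>_def)
  qed
  moreover have "kappa_iter n G j (chain_add ?e d) = kappa n ((G ^^ j) p)"
    if G: "GLUE_scheme n G" for G j
  proof -
    have "chain_add ?e d = map S p"
      using p len by (intro nth_equalityI) (auto simp: d_def)
    moreover have "similarity S"
      unfolding S_def by (rule similarity_orthogonal_transformation[OF \<rho> f])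
    ultimately have "(G ^^ j) (chain_add ?e d) = map S ((G ^^ j) p)"
      using GLUE_iter_similarity[OF G] p by simp
    then show ?thesis
      using kappa_map_similarity[OF f \<rho>] p by (simp add: kappa_iter_def S_def)
  qed
  ultimately show thesis using that by blast
qed

section \<open>One step near the standard chain\<close>

lemma chain_norm_L2: "chain_norm P = L2_set (\<lambda>i. norm (P ! i)) {..<length P}"
  by (simp add: chain_norm_def chain_inner_def L2_set_def power2_norm_eq_inner)

lemma norm_nth_le_chain_norm: "i < length P \<Longrightarrow> norm (P ! i) \<le> chain_norm P"
  unfolding chain_norm_L2 by (rule member_le_L2_set) auto

lemma chain_norm_le:
  assumes "\<And>i. i < length P \<Longrightarrow> norm (P ! i) \<le> b"
  shows "chain_norm P \<le> real (length P) * b"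
proof -
  have "chain_norm P \<le> (\<Sum>i<length P. norm (P ! i))"
    unfolding chain_norm_L2 by (rule L2_set_le_sum) auto
  also have "\<dots> \<le> (\<Sum>i<length P. b)" by (intro sum_mono) (use assms in auto)
  finally show ?thesis by simp
qed

text \<open>A discrete Taylor estimate. Summing second differences twice bounds the remainder
  \<open>r\<close> after removal of a linear chain \<open>q\<close>. As \<open>d\<close> is
  orthogonal to \<open>q\<close>, the square of its norm is the inner product with \<open>r\<close>,
  and Cauchy-Schwarz gives \<open>chain_norm d \<le> chain_norm r\<close>.\<close>

lemma chain_norm_compl_le:
  assumes n: "3 \<le> n" and d: "d \<in> lin_chains_compl n"
  shows "chain_norm d \<le> real n ^ 3 * seminorm 2 d"
proof -
  have len: "length d = n" using d by (simp add: lin_chains_compl_def)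
  define s where "s = seminorm 2 d"
  have s: "0 \<le> s" unfolding s_def using len n by (simp add: seminorm2_nonneg)
  \<comment> \<open>The linear chain through the first two points of \<open>d\<close>, so that
    \<open>r\<close> starts with two zeros.\<close>
  define q where "q = map (\<lambda>i. d ! 0 + real i *\<^sub>R (d ! 1 - d ! 0)) [0..<n]"
  define r where "r = chain_sub d q"
  have q: "q ! i = (d ! 0 + ((real n - 1) / 2) *\<^sub>R (d ! 1 - d ! 0)) + centre n i *\<^sub>R (d ! 1 - d ! 0)"
    if "i < n" for i
    using that by (simp add: q_def centre_def vec_eq_iff field_simps)
  have "length q = n" by (simp add: q_def)
  then have "q \<in> lin_chains n" using q n by (auto simp: lin_chains_iff)
  then have orth: "chain_inner q d = 0" using d by (simp add: lin_chains_compl_def)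
  have r: "r ! i = d ! i - (d ! 0 + real i *\<^sub>R (d ! 1 - d ! 0))" if "i < n" for i
    using that len by (simp add: r_def q_def)
  have diff: "norm (r ! Suc i - r ! i) \<le> real i * s" if "Suc i < n" for i
    using that
  proof (induction i)
    case 0
    then show ?case using n by (simp add: r)
  next
    case (Suc i)
    have "r ! Suc (Suc i) - r ! Suc i
        = (r ! Suc i - r ! i) + (d ! (i + 2) - 2 *\<^sub>R d ! (i + 1) + d ! i)"
      using Suc.prems by (simp add: r vec_eq_iff field_simps)
    also have "norm \<dots> \<le> real i * s + s"
      using Suc second_diff_le_seminorm2[of i d] len by (intro norm_triangle_mono) (auto simp: s_def)
    finally show ?case by (simp add: algebra_simps)
  qed
  have "norm (r ! i) \<le> real i * (real n * s)" if "i < n" for i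
    using that
  proof (induction i)
    case 0
    then show ?case by (simp add: r)
  next
    case (Suc i)
    have "norm (r ! Suc i) \<le> norm (r ! i) + norm (r ! Suc i - r ! i)"
      by norm
    also have "\<dots> \<le> real i * (real n * s) + real i * s"
      using Suc diff[of i] by (intro add_mono) auto
    also have "\<dots> \<le> real i * (real n * s) + real n * s"
      using Suc.prems s by (intro add_left_mono mult_right_mono) auto
    finally show ?case by (simp add: algebra_simps)
  qed
  then have "norm (r ! i) \<le> real n * (real n * s)" if "i < n" for i
    using that s mult_right_mono[of "real i" "real n" "real n * s"]
    by (meson less_imp_le mult_nonneg_nonneg of_nat_0_le_iff of_nat_mono order_trans)
  moreover have "length r = n" using len by (simp add: r_def q_def)
  ultimately have rn: "chain_norm r \<le> real n * (real n * (real n * s))"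
    using chain_norm_le[of r] by simp
  have "(chain_norm d)\<^sup>2 = chain_inner d d"
    by (simp add: chain_norm_def chain_inner_def sum_nonneg)
  also have "\<dots> = chain_inner r d + chain_inner q d"
    unfolding chain_inner_def using \<open>length r = n\<close> \<open>length q = n\<close> len
    by (simp add: r_def flip: sum.distrib inner_add_left)
  also have "\<dots> = chain_inner r d" using orth by simp
  also have "\<dots> \<le> (\<Sum>i<n. \<bar>norm (r ! i)\<bar> * \<bar>norm (d ! i)\<bar>)"
    unfolding chain_inner_def \<open>length r = n\<close>
    by (intro sum_mono) (simp add: norm_cauchy_schwarz)
  also have "\<dots> \<le> chain_norm r * chain_norm d"
    unfolding chain_norm_L2 \<open>length r = n\<close> len by (rule L2_set_mult_ineq)
  finally have "chain_norm d * chain_norm d \<le> chain_norm r * chain_norm d"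
    by (simp add: power2_eq_square)
  moreover have "0 \<le> chain_norm r" "0 \<le> chain_norm d"
    unfolding chain_norm_L2 by (rule L2_set_nonneg)+
  ultimately have "chain_norm d \<le> chain_norm r"
    by (cases "chain_norm d = 0") (auto dest: mult_right_le_imp_le)
  then show ?thesis using rn by (simp add: s_def power3_eq_cube mult.assoc)
qed

text \<open>Differentiability at \<open>X\<close> with tolerance 1: the linear part contributes the
  sum of the operator norms to \<open>K\<close>, the error term the summand 1.\<close>

lemma C1_holder_near_Lipschitz:
  assumes "C1_holder_near \<nu> g X"
  obtains \<eta> K where "0 < \<eta>" "0 \<le> K"
    "\<And>H. length H = length X \<Longrightarrow> chain_norm H < \<eta> \<Longrightarrow>
       norm (g (chain_add X H) - g X) \<le> K * chain_norm H"
proof -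
  obtain r D where "0 < r" and D: "\<And>P. length P = length X \<Longrightarrow> chain_norm (chain_sub P X) < r \<Longrightarrow>
      \<forall>\<epsilon> > 0. \<exists>\<eta> > 0. \<forall>H. length H = length X \<and> chain_norm H < \<eta> \<longrightarrow>
             norm (g (chain_add P H) - g P - (\<Sum>i<length X. blinfun_apply (D P i) (H ! i)))
               \<le> \<epsilon> * chain_norm H"
    using assms unfolding C1_holder_near_def Let_def by blast
  have "chain_norm (chain_sub X X) < r"
    using \<open>0 < r\<close> by (simp add: chain_norm_def chain_inner_def)
  from D[OF refl this, rule_format, OF zero_less_one] obtain \<eta> where "0 < \<eta>"
    and \<eta>: "\<And>H. length H = length X \<Longrightarrow> chain_norm H < \<eta> \<Longrightarrow>
             norm (g (chain_add X H) - g X - (\<Sum>i<length X. blinfun_apply (D X i) (H ! i)))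
               \<le> 1 * chain_norm H"
    by blast
  define K where "K = 1 + (\<Sum>i<length X. norm (D X i))"
  have "norm (g (chain_add X H) - g X) \<le> K * chain_norm H"
    if H: "length H = length X" "chain_norm H < \<eta>" for H
  proof -
    let ?L = "\<Sum>i<length X. blinfun_apply (D X i) (H ! i)"
    have "norm ?L \<le> (\<Sum>i<length X. norm (D X i) * chain_norm H)"
      using H(1)
      by (intro sum_norm_le order_trans[OF norm_blinfun] mult_left_mono norm_nth_le_chain_norm) auto
    moreover have "norm (g (chain_add X H) - g X) \<le> norm (g (chain_add X H) - g X - ?L) + norm ?L"
      by norm
    ultimately show ?thesis
      using \<eta>[OF H] by (simp add: K_def algebra_simps sum_distrib_left)
  qed
  moreover have "0 \<le> K" by (simp add: K_def sum_nonneg)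
  ultimately show thesis using that \<open>0 < \<eta>\<close> by blast
qed

text \<open>Translating the \<open>j\<close>-th window of \<open>e + d\<close> by \<open>-j e\<close> moves it to a perturbation of \<open>E\<^sub>m\<^sub>+\<^sub>1\<close>,
  the only place where the rules \<open>g\<^sub>0\<close>, \<open>g\<^sub>1\<close> are known to be regular.\<close>

lemma GLUE_Lipschitz_at_std_chain:
  fixes G :: "('d::{finite,linorder}) chain \<Rightarrow> 'd chain"
  assumes G: "GLUE_scheme n G"
  obtains \<epsilon> C where "0 < \<epsilon>" "0 \<le> C"
    "\<And>d i. d \<in> lin_chains_compl n \<Longrightarrow> seminorm 2 d \<le> \<epsilon> \<Longrightarrow> i < n + 1 \<Longrightarrow>
       norm (G (chain_add (std_chain n) d) ! i - G (std_chain n) ! i) \<le> C * seminorm 2 d"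
proof -
  obtain m g0 g1 \<nu> where n: "n = 2 * m + 1"
    and g: "\<And>P i. n \<le> length P \<Longrightarrow> i < length P - m \<Longrightarrow>
              G P ! (2 * i) = g0 (take (m + 1) (drop i P)) \<and>
              G P ! (2 * i + 1) = g1 (take (m + 1) (drop i P))"
    and C1: "C1_holder_near \<nu> g0 (std_chain (m + 1))" "C1_holder_near \<nu> g1 (std_chain (m + 1))"
    using G unfolding GLUE_scheme_def by metis
  let ?X = "std_chain (m + 1) :: 'd chain"
  let ?e = "std_chain n :: 'd chain"
  obtain \<eta>0 K0 where 0: "0 < \<eta>0" "0 \<le> K0"
    "\<And>H. length H = m + 1 \<Longrightarrow> chain_norm H < \<eta>0 \<Longrightarrow> norm (g0 (chain_add ?X H) - g0 ?X) \<le> K0 * chain_norm H"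
    using C1_holder_near_Lipschitz[OF C1(1)] by auto
  obtain \<eta>1 K1 where 1: "0 < \<eta>1" "0 \<le> K1"
    "\<And>H. length H = m + 1 \<Longrightarrow> chain_norm H < \<eta>1 \<Longrightarrow> norm (g1 (chain_add ?X H) - g1 ?X) \<le> K1 * chain_norm H"
    using C1_holder_near_Lipschitz[OF C1(2)] by auto
  have n3: "3 \<le> n" using G by (rule GLUE_ge_3)
  \<comment> \<open>Each point of \<open>d\<close> has norm at most
    \<open>real n ^ 3 * seminorm 2 d\<close>, and a stretch has at most \<open>n\<close> points;
    hence \<open>L * seminorm 2 d\<close> bounds the norm of every stretch of
    \<open>d\<close>.\<close>
  define L where "L = real n * real n ^ 3"
  have L: "0 < L" using n3 by (simp add: L_def)
  define \<eta> where "\<eta> = min \<eta>0 \<eta>1"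
  define K where "K = max K0 K1"
  have \<eta>: "0 < \<eta>" using 0 1 by (simp add: \<eta>_def)
  have K: "0 \<le> K" using 0 1 by (simp add: K_def)
  have bound: "norm (G (chain_add ?e d) ! t - G ?e ! t) \<le> K * L * seminorm 2 d"
    if d: "d \<in> lin_chains_compl n" and small: "seminorm 2 d \<le> \<eta> / (2 * L)" and "t < n + 1" for d t
  proof -
    have len: "length d = n" using d by (simp add: lin_chains_compl_def)
    define j where "j = t div 2"
    have tj: "t = 2 * j \<or> t = 2 * j + 1" unfolding j_def by linarith
    have j: "j \<le> m" using \<open>t < n + 1\<close> n tj by linarith
    define S where "S = (\<lambda>x. 1 *\<^sub>R id x + - (real j *\<^sub>R (e1 :: (real, 'd) vec)))"
    have S: "similarity S"
      unfolding S_def by (rule similarity_orthogonal_transformation) (auto simp: orthogonal_transformation_id)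
    define H where "H = take (m + 1) (drop j d)"
    have lenH: "length H = m + 1" using len n j by (simp add: H_def)
    have "norm (d ! i) \<le> real n ^ 3 * seminorm 2 d" if "i < n" for i
      using that norm_nth_le_chain_norm[of i d] chain_norm_compl_le[OF n3 d] len by simp
    then have "norm (H ! i) \<le> real n ^ 3 * seminorm 2 d" if "i < length H" for i
      using that lenH len n j by (simp add: H_def)
    then have "chain_norm H \<le> real (m + 1) * (real n ^ 3 * seminorm 2 d)"
      using chain_norm_le[of H] lenH by metis
    also have "\<dots> \<le> real n * (real n ^ 3 * seminorm 2 d)"
      using n n3 len by (intro mult_right_mono mult_nonneg_nonneg seminorm2_nonneg) auto
    finally have H: "chain_norm H \<le> L * seminorm 2 d" by (simp add: L_def mult.assoc)
    \<comment> \<open>The factor 2 in the smallness bound makes the next inequality strict.\<close>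
    have "L * seminorm 2 d \<le> \<eta> / 2" using small L by (simp add: field_simps)
    then have "chain_norm H < \<eta>" using H \<eta> by linarith
    have nonneg: "0 \<le> chain_norm H" unfolding chain_norm_L2 by (rule L2_set_nonneg)
    have we: "take (m + 1) (drop j (map S ?e)) = ?X"
      using n j by (intro nth_equalityI) (auto simp: S_def vec_eq_iff field_simps)
    have wd: "take (m + 1) (drop j (map S (chain_add ?e d))) = chain_add ?X H"
      using n j len lenH by (intro nth_equalityI) (auto simp: S_def H_def vec_eq_iff field_simps)
    have shift: "G (map S P) ! t = G P ! t - real j *\<^sub>R e1" if "length P = n" for P
    proof -
      have "G (map S P) ! t = S (G P ! t)"
        using that \<open>t < n + 1\<close> by (simp add: GLUE_similarity[OF G S] GLUE_length[OF G])
      then show ?thesis by (simp add: S_def)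
    qed
    have "G (chain_add ?e d) ! t - G ?e ! t = G (map S (chain_add ?e d)) ! t - G (map S ?e) ! t"
      using len by (simp add: shift)
    moreover have "norm (G (map S (chain_add ?e d)) ! t - G (map S ?e) ! t) \<le> K * chain_norm H"
      using tj
    proof
      assume t: "t = 2 * j"
      have "norm (g0 (chain_add ?X H) - g0 ?X) \<le> K0 * chain_norm H"
        using 0(3)[OF lenH] \<open>chain_norm H < \<eta>\<close> by (simp add: \<eta>_def)
      also have "\<dots> \<le> K * chain_norm H" using nonneg by (intro mult_right_mono) (auto simp: K_def)
      finally show ?thesis
        using g[of "map S ?e" j] g[of "map S (chain_add ?e d)" j] t n j len we wd by simp
    next
      assume t: "t = 2 * j + 1"
      have "norm (g1 (chain_add ?X H) - g1 ?X) \<le> K1 * chain_norm H"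
        using 1(3)[OF lenH] \<open>chain_norm H < \<eta>\<close> by (simp add: \<eta>_def)
      also have "\<dots> \<le> K * chain_norm H" using nonneg by (intro mult_right_mono) (auto simp: K_def)
      finally show ?thesis
        using g[of "map S ?e" j] g[of "map S (chain_add ?e d)" j] t n j len we wd by simp
    qed
    moreover have "K * chain_norm H \<le> K * L * seminorm 2 d"
      using H K by (simp add: mult.assoc mult_left_mono)
    ultimately show ?thesis by simp
  qed
  have "0 < \<eta> / (2 * L)" "0 \<le> K * L" using \<eta> K L by auto
  then show thesis using that bound by blast
qed

text \<open>The slope is linear in the points. The estimate keeps the slope of a perturbed chain
  away from zero.\<close>

lemma norm_chain_slope_diff_le:
  assumes "length p = n" "length q = n" "\<And>i. i < n \<Longrightarrow> norm (p ! i - q ! i) \<le> b"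
  shows "norm (chain_slope p - chain_slope q)
    \<le> (\<Sum>i<n. \<bar>centre n i\<bar>) / (\<Sum>i<n. (centre n i)\<^sup>2) * b"
proof -
  have "norm (\<Sum>i<n. centre n i *\<^sub>R (p ! i - q ! i)) \<le> (\<Sum>i<n. \<bar>centre n i\<bar> * b)"
    by (intro sum_norm_le) (use assms in \<open>auto intro: mult_left_mono\<close>)
  moreover have "chain_slope p - chain_slope q
    = (\<Sum>i<n. centre n i *\<^sub>R (p ! i - q ! i)) /\<^sub>R (\<Sum>i<n. (centre n i)\<^sup>2)"
    using assms by (simp add: chain_slope_def scaleR_right_diff_distrib sum_subtractf)
  moreover have "0 \<le> (\<Sum>i<n. (centre n i)\<^sup>2)" by (simp add: sum_nonneg)
  ultimately have "norm (chain_slope p - chain_slope q)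
      \<le> (\<Sum>i<n. \<bar>centre n i\<bar> * b) / (\<Sum>i<n. (centre n i)\<^sup>2)"
    by (simp add: divide_inverse_commute mult_left_mono)
  then show ?thesis by (simp flip: sum_distrib_right)
qed

text \<open>The image of the standard chain is linear with slope
  \<open>(1 / 2) *\<^sub>R e1\<close>. A perturbation of its points by \<open>C * s\<close> creates
  second differences of at most \<open>4 * (C * s)\<close>, while for small \<open>s\<close> the
  slope keeps norm at least 1/4.\<close>

lemma GLUE_kappa_step_std_chain:
  fixes G :: "('d::{finite,linorder}) chain \<Rightarrow> 'd chain"
  assumes G: "GLUE_scheme n G"
  obtains \<epsilon> C where "0 < \<epsilon>" "1 \<le> C"
    "\<And>d. d \<in> lin_chains_compl n \<Longrightarrow> seminorm 2 d \<le> \<epsilon> \<Longrightarrow>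
       kappa n (G (chain_add (std_chain n) d)) \<le> ereal (C * seminorm 2 d)"
proof -
  let ?e = "std_chain n :: 'd chain"
  have n3: "3 \<le> n" using G by (rule GLUE_ge_3)
  obtain \<epsilon> C where \<epsilon>: "0 < \<epsilon>" and C: "0 \<le> C"
    and lip: "\<And>d i. d \<in> lin_chains_compl n \<Longrightarrow> seminorm 2 d \<le> \<epsilon> \<Longrightarrow> i < n + 1 \<Longrightarrow>
       norm (G (chain_add ?e d) ! i - G ?e ! i) \<le> C * seminorm 2 d"
    using GLUE_Lipschitz_at_std_chain[OF G] by blast
  obtain m \<tau> where Ge: "G ?e = map (\<lambda>p. (1 / 2) *\<^sub>R (p + (real m + \<tau>) *\<^sub>R e1)) (std_chain (n + 1))"
    using G unfolding GLUE_scheme_def by blast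
  define M where "M = (\<Sum>i<n. \<bar>centre n i\<bar>) / (\<Sum>i<n. (centre n i)\<^sup>2)"
  have M: "0 \<le> M" by (auto simp: M_def intro!: divide_nonneg_nonneg sum_nonneg)
  \<comment> \<open>Chosen so that the slope changes by at most 1/4, half its norm; the summand 1
    keeps the denominator positive.\<close>
  define \<epsilon>' where "\<epsilon>' = min \<epsilon> (1 / (4 * (M * C + 1)))"
  have pos: "0 < M * C + 1" using M C by (simp add: add_nonneg_pos)
  \<comment> \<open>The factor 16 is 4 divided by 1/4; adding 1 makes the constant at least
    1.\<close>
  have "kappa n (G (chain_add ?e d)) \<le> ereal ((16 * C + 1) * seminorm 2 d)"
    if d: "d \<in> lin_chains_compl n" and small: "seminorm 2 d \<le> \<epsilon>'" for d
  proof -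
    have len: "length d = n" using d by (simp add: lin_chains_compl_def)
    define s where "s = seminorm 2 d"
    have s: "0 \<le> s" using len n3 by (simp add: s_def seminorm2_nonneg)
    have s\<epsilon>: "s \<le> \<epsilon>" using small by (simp add: s_def \<epsilon>'_def)
    have "s \<le> 1 / (4 * (M * C + 1))" using small by (simp add: s_def \<epsilon>'_def)
    then have "4 * (M * C + 1) * s \<le> 1" using pos by (simp add: field_simps)
    then have MCs: "M * (C * s) \<le> 1 / 4" using s by (simp add: algebra_simps)
    let ?N = "chain_add ?e d"
    have lenG: "length (G ?N) = n + 1" using len by (simp add: GLUE_length[OF G])
    have "distortion Q \<le> ereal ((16 * C + 1) * s)" if Qsub: "Q \<in> subchains n (G ?N)" for Q
    proof -
      obtain a where Q: "Q = take n (drop a (G ?N))" and "a + n \<le> length (G ?N)"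
        using Qsub unfolding subchains_def by blast
      \<comment> \<open>The image has \<open>n + 1\<close> points, hence just two subchains of
        length \<open>n\<close>.\<close>
      then have a: "a \<le> 1" using lenG by linarith
      define A where "A = take n (drop a (G ?e))"
      have lenQ: "length Q = n" using Q a lenG by simp
      have lenA: "length A = n" using a by (simp add: A_def Ge)
      have A: "A ! i = ((1 / 2) * (real a + real i + 1 + real m + \<tau>)) *\<^sub>R e1" if "i < n" for i
        using that a by (simp add: A_def Ge flip: scaleR_left_distrib)
      have QA: "norm (Q ! i - A ! i) \<le> C * s" if "i < n" for i
        using lip[OF d, of "a + i"] that a s\<epsilon> lenG by (simp add: Q A_def Ge s_def)
      have "seminorm 2 Q \<le> 4 * (C * s)"
      proof (subst seminorm2_le_iff, use lenQ n3 in simp, intro allI impI)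
        fix i assume i: "i + 2 < length Q"
        then have "A ! (i + 2) - 2 *\<^sub>R A ! (i + 1) + A ! i = 0"
          using lenQ by (simp add: A vec_eq_iff field_simps)
        then have "Q ! (i + 2) - 2 *\<^sub>R Q ! (i + 1) + Q ! i
          = (Q ! (i + 2) - A ! (i + 2)) - 2 *\<^sub>R (Q ! (i + 1) - A ! (i + 1)) + (Q ! i - A ! i)"
          by (simp add: algebra_simps)
        also have "norm \<dots> \<le> norm (Q ! (i + 2) - A ! (i + 2)) + 2 * norm (Q ! (i + 1) - A ! (i + 1))
            + norm (Q ! i - A ! i)"
          by norm
        also have "\<dots> \<le> C * s + 2 * (C * s) + C * s"
          using i lenQ by (intro add_mono mult_left_mono QA) auto
        finally show "norm (Q ! (i + 2) - 2 *\<^sub>R Q ! (i + 1) + Q ! i) \<le> 4 * (C * s)" by simp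
      qed
      moreover have slope: "1 / 4 \<le> norm (chain_slope Q)"
      proof -
        have "chain_slope A = (1 / 2) *\<^sub>R e1"
          by (rule chain_slope_affine[of A n "((1 / 2) * (real a + (real n - 1) / 2 + 1 + real m + \<tau>)) *\<^sub>R e1"])
            (use lenA n3 in \<open>auto simp: A centre_def add_divide_distrib diff_divide_distrib simp flip: scaleR_left_distrib\<close>)
        then have "norm (chain_slope A) = 1 / 2" by simp
        moreover have "norm (chain_slope Q - chain_slope A) \<le> M * (C * s)"
          unfolding M_def by (rule norm_chain_slope_diff_le[OF lenQ lenA QA])
        moreover have "norm (chain_slope A) \<le> norm (chain_slope Q) + norm (chain_slope Q - chain_slope A)"
          by norm
        ultimately show ?thesis using MCs by linarith
      qed
      ultimately have "seminorm 2 Q / norm (chain_slope Q) \<le> (4 * (C * s)) / (1 / 4)"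
        using C s by (intro frac_le) auto
      also have "\<dots> \<le> (16 * C + 1) * s" using s by (simp add: algebra_simps)
      finally show ?thesis using lenQ n3 slope by (auto simp: distortion_eq)
    qed
    then show ?thesis using lenG by (simp add: kappa_le_iff s_def)
  qed
  moreover have "0 < \<epsilon>'" "1 \<le> 16 * C + 1" using \<epsilon> pos C by (auto simp: \<epsilon>'_def)
  ultimately show thesis using that by blast
qed

section \<open>Decay of the distortion\<close>

text \<open>Locality reduces the claim to windows, and the normal form reduces a window to a
  perturbation of the standard chain.\<close>

lemma GLUE_kappa_step:
  assumes G: "GLUE_scheme n G"
  obtains \<epsilon> C where "0 < \<epsilon>" "1 \<le> C"
    "\<And>P x. n \<le> length P \<Longrightarrow> kappa n P \<le> ereal x \<Longrightarrow> x \<le> \<epsilon> \<Longrightarrow> kappa n (G P) \<le> ereal (C * x)"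
proof -
  have n3: "3 \<le> n" using G by (rule GLUE_ge_3)
  obtain \<epsilon> C where \<epsilon>: "0 < \<epsilon>" and C: "1 \<le> C"
    and step: "\<And>d. d \<in> lin_chains_compl n \<Longrightarrow> seminorm 2 d \<le> \<epsilon> \<Longrightarrow>
       kappa n (G (chain_add (std_chain n) d)) \<le> ereal (C * seminorm 2 d)"
    using GLUE_kappa_step_std_chain[OF G] by blast
  have "kappa n (G P) \<le> ereal (C * x)"
    if P: "n \<le> length P" and x: "kappa n P \<le> ereal x" "x \<le> \<epsilon>" for P x
  proof -
    have "kappa n ((G ^^ 1) p) \<le> ereal (C * x)" if p: "p \<in> subchains n P" for p
    proof -
      have len: "length p = n" using p by (rule length_subchain)
      have dist: "distortion p \<le> ereal x"
        using distortion_le_kappa[OF p] x(1) by (rule order_trans)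
      then have "chain_slope p \<noteq> 0" using len n3 by (auto simp: distortion_eq)
      then obtain d where d: "d \<in> lin_chains_compl n" "distortion p = ereal (seminorm 2 d)"
        and same: "\<And>j. kappa_iter n G j (chain_add (std_chain n) d) = kappa n ((G ^^ j) p)"
        using distortion_normal_form[OF len n3] G by metis
      have le: "seminorm 2 d \<le> x" using dist d(2) by simp
      have "kappa n ((G ^^ 1) p) \<le> ereal (C * seminorm 2 d)"
        using step[OF d(1)] same[of 1] le x(2) by (simp add: kappa_iter_def)
      also have "\<dots> \<le> ereal (C * x)" using le C by simp
      finally show ?thesis .
    qed
    then show ?thesis using GLUE_kappa_iter_le[OF G P, of 1] by simp
  qed
  then show thesis using that \<epsilon> C by blast
qed

text \<open>As \<open>C\<close> is at least 1 and \<open>x\<close> nonnegative, smallness at the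
  last step implies smallness at all earlier ones, so the one-step bound can be iterated.\<close>

lemma GLUE_kappa_steps:
  assumes G: "GLUE_scheme n G"
  obtains \<epsilon> C where "0 < \<epsilon>" "1 \<le> C"
    "\<And>P x j. n \<le> length P \<Longrightarrow> kappa n P \<le> ereal x \<Longrightarrow> C ^ j * x \<le> \<epsilon> \<Longrightarrow>
       kappa n ((G ^^ j) P) \<le> ereal (C ^ j * x)"
proof -
  obtain \<epsilon> C where \<epsilon>: "0 < \<epsilon>" and C: "1 \<le> C"
    and step: "\<And>P x. n \<le> length P \<Longrightarrow> kappa n P \<le> ereal x \<Longrightarrow> x \<le> \<epsilon> \<Longrightarrow> kappa n (G P) \<le> ereal (C * x)"
    using GLUE_kappa_step[OF G] by blast
  have "kappa n ((G ^^ j) P) \<le> ereal (C ^ j * x)"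
    if P: "n \<le> length P" and x: "kappa n P \<le> ereal x" and small: "C ^ j * x \<le> \<epsilon>" for P x j
    using small
  proof (induction j)
    case 0
    then show ?case using x by simp
  next
    case (Suc j)
    have "ereal 0 \<le> ereal x"
      using order_trans[OF kappa_nonneg[OF GLUE_ge_3[OF G] P] x] by (simp add: zero_ereal_def)
    then have "1 * (C ^ j * x) \<le> C * (C ^ j * x)"
      using C by (intro mult_right_mono) auto
    then have "C ^ j * x \<le> \<epsilon>" using Suc.prems by (simp add: mult.assoc)
    then show ?case
      using step[OF GLUE_iter_length[OF G P] Suc.IH] by (simp add: mult.assoc)
  qed
  then show thesis using that \<epsilon> C by blast
qed

section \<open>The suprema as contraction factors\<close>

lemma ereal_le_mult_of_divide_le:
  "0 < s \<Longrightarrow> k / ereal s \<le> ereal c \<Longrightarrow> k \<le> ereal (c * s)"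
  by (cases k) (auto simp: field_simps)

text \<open>The normal form of \<open>p\<close> has second-difference seminorm \<open>s\<close>, so
  it is among the chains over which the supremum is taken.\<close>

lemma kappa_le_of_Gamma_range:
  assumes G: "GLUE_scheme n G" and p: "length p = n" "distortion p = ereal s"
    and s: "\<delta> \<le> s" "s \<le> \<gamma>" "0 < s" and \<Gamma>: "Gamma_range n G k \<delta> \<gamma> \<le> ereal q"
  shows "kappa n ((G ^^ k) p) \<le> ereal (q * s)"
proof -
  have n3: "3 \<le> n" using G by (rule GLUE_ge_3)
  have "chain_slope p \<noteq> 0" using p n3 by (auto simp: distortion_eq)
  then obtain d where d: "d \<in> lin_chains_compl n" "distortion p = ereal (seminorm 2 d)"
    and same: "\<And>j. kappa_iter n G j (chain_add (std_chain n) d) = kappa n ((G ^^ j) p)"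
    using distortion_normal_form[OF p(1) n3] G by metis
  have sd: "seminorm 2 d = s" using d(2) p(2) by simp
  have "kappa_iter n G k (chain_add (std_chain n) d) / ereal (seminorm 2 d) \<le> Gamma_range n G k \<delta> \<gamma>"
    unfolding Gamma_range_def by (rule SUP_upper) (use d(1) sd s in auto)
  also note \<Gamma>
  finally show ?thesis
    using s sd by (simp add: same ereal_le_mult_of_divide_le)
qed

text \<open>With the distortion \<open>s\<close> of a window as lower limit, the bound for a range
  of distortions also covers the range down to zero.\<close>

lemma Gamma_range_le_Gamma_upto:
  assumes "0 < s" "s \<le> \<delta>"
  shows "Gamma_range n G l s \<delta> \<le> Gamma_upto n G l \<delta>"
  unfolding Gamma_range_def Gamma_upto_def by (rule SUP_subset_mono) (use assms in auto)

lemma kappa_le_of_Gamma_upto: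
  assumes G: "GLUE_scheme n G" and P: "n \<le> length P" "kappa n P \<le> ereal x" "x \<le> \<delta>"
    and \<Gamma>: "Gamma_upto n G l \<delta> \<le> ereal \<Gamma>" "0 < \<Gamma>"
  shows "kappa n ((G ^^ l) P) \<le> ereal (\<Gamma> * x)"
proof (rule GLUE_kappa_iter_le[OF G P(1)])
  fix p assume p: "p \<in> subchains n P"
  have len: "length p = n" using p by (rule length_subchain)
  have nonneg: "0 \<le> distortion p" using len GLUE_ge_3[OF G] by (simp add: distortion_nonneg)
  have "distortion p \<le> ereal x" using distortion_le_kappa[OF p] P(2) by (rule order_trans)
  then obtain s where s: "distortion p = ereal s" "0 \<le> s" "s \<le> x"
    using nonneg by (cases "distortion p") auto
  show "kappa n ((G ^^ l) p) \<le> ereal (\<Gamma> * x)"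
  proof (cases "s = 0")
    \<comment> \<open>Distortion zero is excluded from the supremum; here the Lipschitz bound with
      \<open>x = 0\<close> shows that it stays zero.\<close>
    case True
    obtain \<epsilon> C where "0 < \<epsilon>" "1 \<le> C"
      and steps: "\<And>P x j. n \<le> length P \<Longrightarrow> kappa n P \<le> ereal x \<Longrightarrow> C ^ j * x \<le> \<epsilon> \<Longrightarrow>
         kappa n ((G ^^ j) P) \<le> ereal (C ^ j * x)"
      using GLUE_kappa_steps[OF G] by blast
    have "kappa n ((G ^^ l) p) \<le> ereal (C ^ l * 0)"
      using len s(1) True \<open>0 < \<epsilon>\<close> by (intro steps) (auto simp: kappa_self)
    also have "\<dots> \<le> ereal (\<Gamma> * x)" using s \<Gamma>(2) by simp
    finally show ?thesis .
  next
    case False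
    then have "kappa n ((G ^^ l) p) \<le> ereal (\<Gamma> * s)"
      using s P(3) \<Gamma>(1) Gamma_range_le_Gamma_upto[of s \<delta> n G l]
      by (intro kappa_le_of_Gamma_range[OF G len s(1), of s \<delta>]) auto
    also have "\<dots> \<le> ereal (\<Gamma> * x)" using s \<Gamma>(2) by simp
    finally show ?thesis .
  qed
qed

text \<open>The free constant and the free starting index make decay insensitive to finitely many
  initial steps, which may differ from window to window.\<close>

definition decays :: "nat \<Rightarrow> (('d::finite) chain \<Rightarrow> 'd chain) \<Rightarrow> real \<Rightarrow> 'd chain \<Rightarrow> bool" where
  "decays n G \<theta> P \<longleftrightarrow>
     (\<exists>B. \<forall>\<^sub>F j in sequentially. kappa n ((G ^^ j) P) \<le> ereal (B * \<theta> powr real j))"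

text \<open>There are finitely many windows, so their bounds hold simultaneously from some index on,
  with the largest constant.\<close>

lemma decays_subchains:
  assumes G: "GLUE_scheme n G" and P: "n \<le> length P"
    and dec: "\<And>p. p \<in> subchains n P \<Longrightarrow> decays n G \<theta> p"
  shows "decays n G \<theta> P"
proof -
  obtain B where B: "\<And>p. p \<in> subchains n P \<Longrightarrow>
      \<forall>\<^sub>F j in sequentially. kappa n ((G ^^ j) p) \<le> ereal (B p * \<theta> powr real j)"
    using dec unfolding decays_def by metis
  define M where "M = Max (B ` subchains n P)"
  have "\<forall>\<^sub>F j in sequentially. \<forall>p\<in>subchains n P. kappa n ((G ^^ j) p) \<le> ereal (B p * \<theta> powr real j)"
    using B by (intro eventually_ball_finite) auto
  then have "\<forall>\<^sub>F j in sequentially. kappa n ((G ^^ j) P) \<le> ereal (M * \<theta> powr real j)"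
  proof eventually_elim
    case (elim j)
    show ?case
    proof (rule GLUE_kappa_iter_le[OF G P])
      fix p assume p: "p \<in> subchains n P"
      have "B p \<le> M" unfolding M_def using p by (intro Max_ge) auto
      then have "ereal (B p * \<theta> powr real j) \<le> ereal (M * \<theta> powr real j)"
        by (simp add: mult_right_mono)
      then show "kappa n ((G ^^ j) p) \<le> ereal (M * \<theta> powr real j)"
        using elim p order_trans by blast
    qed
  qed
  then show ?thesis unfolding decays_def by blast
qed

text \<open>A delay of \<open>t\<close> steps is absorbed into the constant by the factor
  \<open>\<theta> powr (- real t)\<close>.\<close>

lemma decays_funpow:
  assumes "decays n G \<theta> ((G ^^ t) P)" "0 < \<theta>"
  shows "decays n G \<theta> P"
proof -
  obtain B where "\<forall>\<^sub>F j in sequentially. kappa n ((G ^^ j) ((G ^^ t) P)) \<le> ereal (B * \<theta> powr real j)"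
    using assms(1) unfolding decays_def by blast
  then have "\<forall>\<^sub>F j in sequentially.
      kappa n ((G ^^ (j + t)) P) \<le> ereal (B * \<theta> powr (- real t) * \<theta> powr real (j + t))"
    using assms(2) by (simp add: funpow_add powr_add powr_minus field_simps)
  then show ?thesis
    unfolding decays_def
    using eventually_sequentially_seg[of "\<lambda>j. kappa n ((G ^^ j) P)
      \<le> ereal (B * \<theta> powr (- real t) * \<theta> powr real j)" t]
    by blast
qed

text \<open>Between multiples of \<open>l\<close> the distortion is controlled by the Lipschitz bound alone; this is where
  the regularity of the scheme enters.\<close>

lemma GLUE_decays_small:
  assumes G: "GLUE_scheme n G" and "0 < \<delta>" "1 \<le> l"
    and \<Gamma>: "Gamma_upto n G l \<delta> \<le> ereal \<Gamma>" "0 < \<Gamma>" "\<Gamma> < 1"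
  obtains \<epsilon> where "0 < \<epsilon>"
    "\<And>P x. n \<le> length P \<Longrightarrow> kappa n P \<le> ereal x \<Longrightarrow> x \<le> \<epsilon> \<Longrightarrow> decays n G (\<Gamma> powr (1 / real l)) P"
proof -
  obtain \<epsilon> C where \<epsilon>: "0 < \<epsilon>" and C: "1 \<le> C"
    and steps: "\<And>P x j. n \<le> length P \<Longrightarrow> kappa n P \<le> ereal x \<Longrightarrow> C ^ j * x \<le> \<epsilon> \<Longrightarrow>
       kappa n ((G ^^ j) P) \<le> ereal (C ^ j * x)"
    using GLUE_kappa_steps[OF G] by blast
  \<comment> \<open>Below \<open>\<delta>\<close> the contraction by \<open>\<Gamma>\<close>
    applies; below \<open>\<epsilon> / C ^ l\<close> the Lipschitz bound survives fewer than
    \<open>l\<close> steps.\<close>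
  define \<epsilon>' where "\<epsilon>' = min \<delta> (\<epsilon> / C ^ l)"
  have nonneg: "0 \<le> x" if "n \<le> length P" "kappa n P \<le> ereal x" for P and x :: real
    using order_trans[OF kappa_nonneg[OF GLUE_ge_3[OF G] that(1)] that(2)]
    by (simp add: zero_ereal_def)
  \<comment> \<open>A block of \<open>l\<close> steps is split off at the beginning; the induction
    hypothesis is used for \<open>(G ^^ l) P\<close> and \<open>\<Gamma> * x\<close>, so both
    \<open>P\<close> and \<open>x\<close> vary.\<close>
  have blocks: "kappa n ((G ^^ j) P) \<le> ereal (C ^ l * \<Gamma> ^ (j div l) * x)"
    if "n \<le> length P" "kappa n P \<le> ereal x" "x \<le> \<epsilon>'" for P x j
    using that
  proof (induction j arbitrary: P x rule: less_induct)
    case (less j)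
    have x: "0 \<le> x" using nonneg less.prems by blast
    show ?case
    proof (cases "j < l")
      case True
      have "C ^ j \<le> C ^ l" using C True by (intro power_increasing) auto
      then have le: "C ^ j * x \<le> C ^ l * x" using x by (rule mult_right_mono)
      have "C ^ l * x \<le> \<epsilon>"
        using less.prems(3) C by (simp add: \<epsilon>'_def field_simps)
      then have "kappa n ((G ^^ j) P) \<le> ereal (C ^ j * x)"
        using le less.prems by (intro steps) auto
      also have "\<dots> \<le> ereal (C ^ l * \<Gamma> ^ (j div l) * x)" using le True by simp
      finally show ?thesis .
    next
      case False
      define i where "i = j - l"
      have j: "j = i + l" "i < j" using False \<open>1 \<le> l\<close> by (auto simp: i_def)
      have "kappa n ((G ^^ l) P) \<le> ereal (\<Gamma> * x)"
        using less.prems by (intro kappa_le_of_Gamma_upto[OF G _ _ _ \<Gamma>(1,2)]) (auto simp: \<epsilon>'_def)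
      moreover have "\<Gamma> * x \<le> \<epsilon>'"
        using mult_right_mono[of \<Gamma> 1 x] x \<Gamma>(3) less.prems(3) by simp
      ultimately have "kappa n ((G ^^ i) ((G ^^ l) P)) \<le> ereal (C ^ l * \<Gamma> ^ (i div l) * (\<Gamma> * x))"
        using less.IH[OF j(2) GLUE_iter_length[OF G less.prems(1)]] by blast
      then show ?thesis
        using \<open>1 \<le> l\<close> by (simp add: j(1) funpow_add mult.assoc mult.left_commute)
    qed
  qed
  have "decays n G (\<Gamma> powr (1 / real l)) P"
    if P: "n \<le> length P" "kappa n P \<le> ereal x" "x \<le> \<epsilon>'" for P x
  proof -
    have x: "0 \<le> x" using nonneg P by blast
    have "kappa n ((G ^^ j) P) \<le> ereal (C ^ l * x / \<Gamma> * (\<Gamma> powr (1 / real l)) powr real j)" for j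
    proof -
      \<comment> \<open>Rounding \<open>j / l\<close> down costs at most one factor
        \<open>1 / \<Gamma>\<close>, which enters the constant.\<close>
      have "j < l + l * (j div l)"
        using dividend_less_times_div[of l j] \<open>1 \<le> l\<close> by simp
      then have "real j < real l + real l * real (j div l)"
        by (simp only: of_nat_less_iff flip: of_nat_add of_nat_mult)
      then have "real j / real l - 1 \<le> real (j div l)"
        using \<open>1 \<le> l\<close> by (simp add: field_simps)
      then have "\<Gamma> powr real (j div l) \<le> \<Gamma> powr (real j / real l - 1)"
        using \<Gamma> by (intro powr_mono') auto
      then have "\<Gamma> ^ (j div l) \<le> (\<Gamma> powr (1 / real l)) powr real j / \<Gamma>"
        using \<Gamma> by (simp add: powr_realpow powr_diff powr_powr)
      then have "C ^ l * x * \<Gamma> ^ (j div l) \<le> C ^ l * x * ((\<Gamma> powr (1 / real l)) powr real j / \<Gamma>)"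
        using C x by (intro mult_left_mono) auto
      then have "ereal (C ^ l * \<Gamma> ^ (j div l) * x)
        \<le> ereal (C ^ l * x / \<Gamma> * (\<Gamma> powr (1 / real l)) powr real j)"
        by (simp add: mult_ac)
      then show ?thesis using blocks[OF P, of j] by (rule order_trans[rotated])
    qed
    then show ?thesis unfolding decays_def by (intro exI[of _ "C ^ l * x / \<Gamma>"] always_eventually allI)
  qed
  moreover have "0 < \<epsilon>'" using \<open>0 < \<delta>\<close> \<epsilon> C by (simp add: \<epsilon>'_def)
  ultimately show thesis using that by blast
qed

lemma GLUE_decays:
  assumes G: "GLUE_scheme n G" and "0 < \<delta>" "\<delta> < \<gamma>" "1 \<le> l"
    and range: "Gamma_range n G k \<delta> \<gamma> < 1"
    and \<Gamma>: "Gamma_upto n G l \<delta> \<le> ereal \<Gamma>" "0 < \<Gamma>" "\<Gamma> < 1"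
    and P: "P \<in> chains_bounded n \<gamma>"
  shows "decays n G (\<Gamma> powr (1 / real l)) P"
proof -
  let ?\<theta> = "\<Gamma> powr (1 / real l)"
  obtain \<epsilon> where \<epsilon>: "0 < \<epsilon>"
    and small: "\<And>P x. n \<le> length P \<Longrightarrow> kappa n P \<le> ereal x \<Longrightarrow> x \<le> \<epsilon> \<Longrightarrow> decays n G ?\<theta> P"
    using GLUE_decays_small[OF G \<open>0 < \<delta>\<close> \<open>1 \<le> l\<close> \<Gamma>] by blast
  \<comment> \<open>The formal value minus infinity is covered by \<open>q' = 0\<close>.\<close>
  obtain q' where q': "Gamma_range n G k \<delta> \<gamma> \<le> ereal q'" "q' < 1"
    using range by (cases "Gamma_range n G k \<delta> \<gamma>") (auto intro: that[of 0] that simp: one_ereal_def)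
  define q where "q = max \<Gamma> q'"
  have q: "0 < q" "q < 1" "\<Gamma> \<le> q" using \<Gamma> q' by (auto simp: q_def)
  have rq: "Gamma_range n G k \<delta> \<gamma> \<le> ereal q"
    using q'(1) by (rule order_trans) (simp add: q_def)
  \<comment> \<open>The number of steps is \<open>l\<close> or \<open>k\<close> according to the
    size of \<open>s\<close>; the existential quantifier hides the choice.\<close>
  have contract: "\<exists>t. kappa n ((G ^^ t) p) \<le> ereal (q * s)"
    if p: "length p = n" "distortion p = ereal s" "0 \<le> s" "s \<le> \<gamma>" for p s
  proof (cases "s \<le> \<delta>")
    case True
    then have "kappa n ((G ^^ l) p) \<le> ereal (\<Gamma> * s)"
      using p by (intro kappa_le_of_Gamma_upto[OF G _ _ _ \<Gamma>(1,2)]) (auto simp: kappa_self)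
    also have "\<dots> \<le> ereal (q * s)" using q p(3) by (simp add: mult_right_mono)
    finally show ?thesis by blast
  next
    case False
    then show ?thesis
      using kappa_le_of_Gamma_range[OF G p(1,2) _ p(4) _ rq] \<open>0 < \<delta>\<close> by auto
  qed
  \<comment> \<open>Here \<open>N\<close> counts the contractions by \<open>q\<close> that suffice
    to reach \<open>\<epsilon>\<close>. After one contraction every subchain of the new chain is a
    window of its own, with its own later step numbers.\<close>
  have windows: "decays n G ?\<theta> p"
    if "length p = n" "distortion p \<le> ereal x" "x \<le> \<gamma>" "q ^ N * x \<le> \<epsilon>" for p x N
    using that
  proof (induction N arbitrary: p x)
    case 0
    then show ?case using small[of p x] by (simp add: kappa_self)
  next
    case (Suc N)
    have "0 \<le> distortion p" using Suc.prems(1) GLUE_ge_3[OF G] by (simp add: distortion_nonneg)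
    then obtain s where s: "distortion p = ereal s" "0 \<le> s" "s \<le> x"
      using Suc.prems(2) by (cases "distortion p") auto
    obtain t where t: "kappa n ((G ^^ t) p) \<le> ereal (q * s)"
      using contract[of p s] Suc.prems s by auto
    have "decays n G ?\<theta> ((G ^^ t) p)"
    proof (rule decays_subchains[OF G])
      show "n \<le> length ((G ^^ t) p)" using Suc.prems(1) by (intro GLUE_iter_length[OF G]) simp
      fix Q assume Q: "Q \<in> subchains n ((G ^^ t) p)"
      show "decays n G ?\<theta> Q"
      proof (rule Suc.IH)
        show "length Q = n" using Q by (rule length_subchain)
        show "distortion Q \<le> ereal (q * s)" using distortion_le_kappa[OF Q] t by (rule order_trans)
        \<comment> \<open>Staying below \<open>\<gamma>\<close> keeps the contraction
          applicable.\<close>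
        show "q * s \<le> \<gamma>" using mult_right_mono[of q 1 s] q s Suc.prems(3) by simp
        have "q ^ Suc N * s \<le> q ^ Suc N * x" using q s by (intro mult_left_mono) auto
        then show "q ^ N * (q * s) \<le> \<epsilon>" using Suc.prems(4) by (simp add: mult_ac)
      qed
    qed
    then show ?case by (rule decays_funpow) (use \<Gamma>(2) in simp)
  qed
  obtain N where N: "q ^ N < \<epsilon> / \<gamma>"
    using real_arch_pow_inv[of "\<epsilon> / \<gamma>" q] \<epsilon> q \<open>0 < \<delta>\<close> \<open>\<delta> < \<gamma>\<close> by auto
  have P': "n \<le> length P" "kappa n P \<le> ereal \<gamma>" using P by (auto simp: chains_bounded_def)
  show ?thesis
  proof (rule decays_subchains[OF G P'(1)])
    fix p assume p: "p \<in> subchains n P"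
    show "decays n G ?\<theta> p"
    proof (rule windows)
      show "length p = n" using p by (rule length_subchain)
      show "distortion p \<le> ereal \<gamma>" using distortion_le_kappa[OF p] P'(2) by (rule order_trans)
      show "q ^ N * \<gamma> \<le> \<epsilon>" using N \<open>0 < \<delta>\<close> \<open>\<delta> < \<gamma>\<close> by (simp add: field_simps)
    qed simp
  qed
qed

text \<open>With rate \<open>- log 2 \<theta>\<close> the weight at index \<open>j\<close> is the
  inverse of \<open>\<theta> powr real j\<close> and cancels the decay.\<close>

lemma straightened_if_decays:
  assumes G: "GLUE_scheme n G" and "n \<le> length P" "0 < \<theta>" "\<theta> < 1" "decays n G \<theta> P"
  shows "straightened n G (- log 2 \<theta>) P"
proof -
  obtain B j0 where B: "\<And>j. j0 \<le> j \<Longrightarrow> kappa n ((G ^^ j) P) \<le> ereal (B * \<theta> powr real j)"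
    using assms(5) unfolding decays_def eventually_sequentially by blast
  let ?x = "\<lambda>j. ereal (2 powr (real j * - log 2 \<theta>)) * kappa_iter n G j P"
  have bound: "\<bar>?x j\<bar> \<le> ereal B" if j0: "j0 \<le> j" for j
  proof -
    have "0 \<le> kappa n ((G ^^ j) P)"
      using GLUE_ge_3[OF G] GLUE_iter_length[OF G assms(2)] by (rule kappa_nonneg)
    then obtain y where y: "kappa n ((G ^^ j) P) = ereal y" "0 \<le> y" "y \<le> B * \<theta> powr real j"
      using B[OF j0] by (cases "kappa n ((G ^^ j) P)") auto
    have "(2::real) powr (real j * - log 2 \<theta>) = (2 powr (log 2 \<theta>)) powr (- real j)"
      by (simp only: powr_powr) (simp add: mult.commute)
    also have "\<dots> = inverse (\<theta> powr real j)"
      using assms(3) by (simp add: powr_minus)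
    finally have x: "?x j = ereal (inverse (\<theta> powr real j) * y)"
      using y(1) by (simp add: kappa_iter_def)
    have "inverse (\<theta> powr real j) * y \<le> inverse (\<theta> powr real j) * (B * \<theta> powr real j)"
      using y(3) by (intro mult_left_mono) auto
    also have "\<dots> = B" using assms(3) by simp
    finally show ?thesis
      unfolding x using y(2) by (simp add: abs_mult)
  qed
  \<comment> \<open>From \<open>j0\<close> on the weighted values are bounded, so infinite ones
    occur only earlier.\<close>
  have "{j. 1 \<le> j \<and> ?x j = \<infinity>} \<subseteq> {..<j0}"
  proof
    fix j assume "j \<in> {j. 1 \<le> j \<and> ?x j = \<infinity>}"
    then show "j \<in> {..<j0}" using bound[of j] by (cases "j0 \<le> j") auto
  qed
  then have "finite {j. 1 \<le> j \<and> ?x j = \<infinity>}" by (rule finite_subset) simp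
  moreover have "0 < - log 2 \<theta>" using assms(3,4) by (simp add: log_less_zero_cancel_iff)
  ultimately show ?thesis
    unfolding straightened_def ess_bounded_def using bound by blast
qed

theorem theorem4p4:
  fixes G :: "('d::{finite,linorder}) chain \<Rightarrow> 'd chain"
    and n k l :: nat and \<delta> \<gamma> \<Gamma> :: real
  assumes "GLUE_scheme n G"
    and "0 < \<delta>" and "\<delta> < \<gamma>"
    and "1 \<le> k" and "1 \<le> l"
    and "Gamma_range n G k \<delta> \<gamma> < 1"
    and "Gamma_upto n G l \<delta> \<le> ereal \<Gamma>" and "\<Gamma> < 1" and "0 < \<Gamma>"
  shows "\<forall>P \<in> chains_bounded n \<gamma>. straightened n G (- (log 2 \<Gamma> / real l)) P"
proof
  fix P :: "'d chain" assume P: "P \<in> chains_bounded n \<gamma>"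
  \<comment> \<open>A factor \<open>\<Gamma>\<close> per \<open>l\<close> steps amounts to
    \<open>\<Gamma> powr (1 / real l)\<close> per step, whose negative binary logarithm is the
    claimed rate.\<close>
  have "decays n G (\<Gamma> powr (1 / real l)) P"
    using assms P by (intro GLUE_decays) auto
  moreover have "\<Gamma> powr (1 / real l) < 1"
    using assms powr_less_mono2[of "1 / real l" \<Gamma> 1] by simp
  moreover have "log 2 (\<Gamma> powr (1 / real l)) = log 2 \<Gamma> / real l"
    using assms by (simp add: log_powr)
  ultimately show "straightened n G (- (log 2 \<Gamma> / real l)) P"
    using straightened_if_decays[of n G P "\<Gamma> powr (1 / real l)"] assms P
    by (simp add: chains_bounded_def)
qed

end
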